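(* Let $h>0$ and let $h_0=\frac{\sqrt3-1}{2}$. Identify the polynomial $ax^2+bxy+cy^2$ with the triple $(a,b,c)\in\mathbb R^3$, and let $\operatorname{ext}(\mathsf B_h)$ denote the set of extreme points of $\mathsf B_h$. (a) If $h\ge h_0$, then $\operatorname{ext}(\mathsf B_h)$ consists exactly of the following elements: $$\pm\left(t,\frac{1-h^2t-\Gamma_h(t)}{h},\Gamma_h(t)\right),\quad t\in\left[-\frac1{(h+1)^2},\frac1{(h+1)^2}\right],$$ $$\pm\left(-\frac1{(h+1)^2},\frac{2\sqrt{1-s}}{h+1},s\right),\quad s\in\left[0,\frac{2h+1}{(h+1)^2}\right],$$ $$\pm\left(\frac1{(h+1)^2},-\frac{2\sqrt{2s}}{h+1},s\right),\quad s\in\left[2,\left(\frac{\sqrt{2h^2+2h+1}+\sqrt2\,h}{h+1}\right)^2\right],$$ $$\pm(0,0,1),\quad \pm\left(\frac1{(h+1)^2},0,0\right),\quad \pm\left(\frac1{(h+1)^2},-\frac{2h+1}{(h+1)^2},\frac{2h+1}{h+1}\right).$$ (b) If $0<h<h_0$, then $\operatorname{ext}(\mathsf B_h)$ consists exactly of the following elements: $$\pm\left(t,\frac{1-h^2t-\Gamma_h(t)}{h},\Gamma_h(t)\right),\quad t\in\left[-\frac1{(h+1)^2},\frac{2h}{h+1}\right],$$ $$\pm\left(-\frac1{(h+1)^2},\frac{2\sqrt{1-s}}{h+1},s\right),\quad s\in\left[0,\frac{2h+1}{(h+1)^2}\right],$$ $$\pm(0,0,1),\quad \pm\left(\frac1{(h+1)^2},-\frac{2h^2+6h+3}{(h+1)^2},\frac{2h^2+4h+1}{h+1}\right),$$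 $$\pm\left(\frac1{(h+1)^2},0,0\right),\quad \pm\left(\frac1{(h+1)^2},-\frac{2h+1}{(h+1)^2},\frac{2h+1}{h+1}\right).$$
   Context: For $h>0$ let $\square_h=[h,h+1]\times[0,1]\subseteq\mathbb R^2$. For $(a,b,c)\in\mathbb R^3$ put $$\|(a,b,c)\|_h=\sup\{|ax^2+bxy+cy^2|:(x,y)\in\square_h\},$$ which is a norm on $\mathbb R^3$ (identified with the space of $2$-homogeneous polynomials on $\mathbb R^2$), and let $\mathsf B_h=\{(a,b,c)\in\mathbb R^3:\|(a,b,c)\|_h\le1\}$ be its closed unit ball. Put $a_h=\frac1{(h+1)^2}$ and define $\Gamma_h:[-a_h,a_h]\to\mathbb R$ by $$\Gamma_h(a)=\left[\sqrt{1+h^2a_h}+h\sqrt{a+a_h}\right]^2.$$ (For $0<h\le h_0$ one has $\frac{2h}{h+1}\le a_h$.) *)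

theory Defs
  imports "HOL-Analysis.Analysis"
begin

definition square :: "real \<Rightarrow> (real \<times> real) set" where
  "square h = {h..h + 1} \<times> {0..1}"

fun quad_form :: "real \<times> real \<times> real \<Rightarrow> real \<times> real \<Rightarrow> real" where
  "quad_form (a, b, c) (x, y) = a * x^2 + b * x * y + c * y^2"

text \<open>The square is nonempty and compact, so the supremum below is the genuine one.\<close>

definition sup_norm :: "real \<Rightarrow> real \<times> real \<times> real \<Rightarrow> real" where
  "sup_norm h p = (SUP z\<in>square h. \<bar>quad_form p z\<bar>)"

definition unit_ball :: "real \<Rightarrow> (real \<times> real \<times> real) set" where
  "unit_ball h = {p. sup_norm h p \<le> 1}"

definition ext :: "'a::real_vector set \<Rightarrow> 'a set" where
  "ext S = {p. p extreme_point_of S}"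

definition bound_a :: "real \<Rightarrow> real" where
  "bound_a h = 1 / (h + 1)^2"

text \<open>Only the values on \<open>{- bound_a h..bound_a h}\<close> are meaningful.\<close>

definition Gamma_fun :: "real \<Rightarrow> real \<Rightarrow> real" where
  "Gamma_fun h a = (sqrt (1 + h^2 * bound_a h) + h * sqrt (a + bound_a h))^2"

definition plus_minus :: "'a::uminus set \<Rightarrow> 'a set" where
  "plus_minus S = S \<union> uminus ` S"

end

theory Submission
  imports Defs
begin

text \<open>A quadratic form scales by the square of the factor along each ray from the origin, so on the
  square its modulus is largest, along each ray, at the point where the ray leaves the square: on
  the right edge or on the top edge. Put \<open>k = h + 1\<close>, \<open>r = h / k\<close> and
  \<open>(A, B, C) = (k\<^sup>2 a, k b, c)\<close>. On the right edge the form reads \<open>f y = A + B y + C y\<^sup>2\<close> with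
  \<open>y\<close> in \<open>[0, 1]\<close>, and on the top edge it is the reversed quadratic \<open>g u = C + B u + A u\<^sup>2\<close> with
  \<open>u\<close> in \<open>[r, 1]\<close>. Thus the unit ball becomes the set \<open>normal_ball r\<close> of coefficient triples for which
  \<open>\<bar>f\<bar>\<close> and \<open>\<bar>g\<bar>\<close> are at most \<open>1\<close>. The corner of the square is counted as \<open>y = 1\<close> and as \<open>u = 1\<close>.

  A point \<open>p\<close> of a convex set is extreme iff \<open>p + d\<close> and \<open>p - d\<close> can both lie in the set for
  \<open>d = 0\<close> only. Call \<open>y\<close> a contact if \<open>\<bar>f y\<bar> = 1\<close>, and likewise for \<open>g\<close>; a contact is tangential
  if the derivative vanishes there as well. An admissible direction \<open>d\<close>, read as a quadratic,
  vanishes at every contact, and to second order at a tangential one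
  (\<open>admissible_direction_vanishes_at_contact\<close>). Conversely, if \<open>f\<close> and \<open>g\<close> are not constantly
  \<open>1\<close> or \<open>-1\<close>, every \<open>d\<close> with these zeros is bounded by a multiple of \<open>1 - \<bar>f\<bar>\<close> and of
  \<open>1 - \<bar>g\<bar>\<close>, so a small multiple of it is admissible (\<open>extreme_contact\<close>). As \<open>d\<close> has three
  coefficients, extremality means that the contacts impose three conditions, a tangential
  contact counting twice.

  This leaves few possibilities, up to sign. If \<open>f\<close> touches \<open>-1\<close> tangentially, the third condition
  can only be \<open>f 0 = 1\<close> or \<open>g r = 1\<close> (\<open>valley\<close>). If \<open>g\<close> touches \<open>1\<close> tangentially, it can only be
  \<open>f 0 = -1\<close> (\<open>ridge\<close>). Without tangency a contact must be an end point of an interval, since an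
  interior contact is an extremum; so \<open>f 0\<close>, \<open>f 1\<close> and \<open>g r\<close> are all \<open>1\<close> or \<open>-1\<close>, and the
  sign patterns compatible with the bounds are \<open>(1, 1, 1)\<close> and, when \<open>r\<^sup>2 - 4 r + 1 > 0\<close>, \<open>(1, -1, 1)\<close>.
  The constant \<open>f\<close> and \<open>g\<close> belong to multiples of \<open>x\<^sup>2\<close> and \<open>y\<^sup>2\<close>. The inequality
  \<open>r\<^sup>2 - 4 r + 1 > 0\<close> says \<open>h < (sqrt 3 - 1) / 2\<close>: the parabolas \<open>f\<close> with minimum \<open>-1\<close> and \<open>g r = 1\<close>
  have their vertex pushed to the corner \<open>y = 1\<close> before \<open>f 0\<close> can grow to \<open>1\<close>.\<close>

section \<open>Extreme points and admissible directions\<close>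

text \<open>Every open segment through \<open>p\<close> contains a symmetric segment centred at \<open>p\<close>.\<close>
lemma ext_iff_rigid:
  fixes S :: "'a::real_vector set"
  assumes "convex S"
  shows "p \<in> ext S \<longleftrightarrow> p \<in> S \<and> (\<forall>d. p + d \<in> S \<and> p - d \<in> S \<longrightarrow> d = 0)"
proof (intro iffI conjI allI impI)
  assume "p \<in> ext S"
  then have p: "p \<in> S" "\<And>a b. a \<in> S \<Longrightarrow> b \<in> S \<Longrightarrow> p \<notin> open_segment a b"
    by (auto simp: ext_def extreme_point_of_def)
  show "p \<in> S" by fact
  fix d assume d: "p + d \<in> S \<and> p - d \<in> S"
  show "d = 0"
  proof (rule ccontr)
    assume "d \<noteq> 0"
    have "p - d \<noteq> p + d"
    proof
      assume "p - d = p + d"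
      then have "d + d = 0" by (simp add: algebra_simps)
      then have "2 *\<^sub>R d = 0" by (simp only: scaleR_2)
      with \<open>d \<noteq> 0\<close> show False by simp
    qed
    moreover have "p = (1 - 1/2) *\<^sub>R (p - d) + (1/2) *\<^sub>R (p + d)"
      by (simp add: algebra_simps flip: scaleR_add_left)
    ultimately have "p \<in> open_segment (p - d) (p + d)"
      unfolding in_segment by (intro conjI exI[of _ "1/2"]) auto
    with p(2) d show False by blast
  qed
next
  assume R: "p \<in> S \<and> (\<forall>d. p + d \<in> S \<and> p - d \<in> S \<longrightarrow> d = 0)"
  have "p \<notin> open_segment a b" if "a \<in> S" "b \<in> S" for a b
  proof
    assume "p \<in> open_segment a b"
    then obtain t where t: "a \<noteq> b" "0 < t" "t < 1" "p = (1 - t) *\<^sub>R a + t *\<^sub>R b"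
      unfolding in_segment by auto
    define m where "m = min t (1 - t)"
    have m: "0 < m" "m \<le> t" "m \<le> 1 - t" using t by (auto simp: m_def)
    have "p + m *\<^sub>R (b - a) = (1 - (t + m)) *\<^sub>R a + (t + m) *\<^sub>R b"
      "p - m *\<^sub>R (b - a) = (1 - (t - m)) *\<^sub>R a + (t - m) *\<^sub>R b"
      unfolding t(4) by (simp_all add: algebra_simps)
    moreover have "(1 - (t + m)) *\<^sub>R a + (t + m) *\<^sub>R b \<in> S"
      "(1 - (t - m)) *\<^sub>R a + (t - m) *\<^sub>R b \<in> S"
      using m t that by (auto intro!: convexD[OF assms])
    ultimately have "m *\<^sub>R (b - a) = 0" using R by metis
    with m t show False by simp
  qed
  with R show "p \<in> ext S" by (auto simp: ext_def extreme_point_of_def)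
qed

section \<open>Quadratics that are nonnegative on an interval\<close>

definition quad :: "real \<Rightarrow> real \<Rightarrow> real \<Rightarrow> real \<Rightarrow> real" where
  "quad a b c x = a + b * x + c * x\<^sup>2"

definition quad' :: "real \<Rightarrow> real \<Rightarrow> real \<Rightarrow> real" where
  "quad' b c x = b + 2 * c * x"

text \<open>The Taylor expansion at \<open>z\<close>; at a zero \<open>z\<close> it exhibits the linear factor.\<close>
lemma quad_at: "quad a b c x = quad a b c z + (x - z) * (quad' b c z + c * (x - z))"
  by (simp add: quad_def quad'_def algebra_simps power2_eq_square)

text \<open>A negative slope at a zero would make the quadratic negative just to the right of it.\<close>
lemma quad_nonneg_right_zero:
  assumes "\<And>x. z \<le> x \<Longrightarrow> x \<le> \<beta> \<Longrightarrow> 0 \<le> quad a b c x" "quad a b c z = 0" "z < \<beta>"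
  shows "0 \<le> quad' b c z"
proof (rule ccontr)
  define D where "D = quad' b c z"
  assume "\<not> 0 \<le> quad' b c z"
  then have D: "D < 0" by (simp add: D_def)
  define s where "s = min (\<beta> - z) (- D / (2 * (\<bar>c\<bar> + 1)))"
  have s: "0 < s" "z + s \<le> \<beta>" using D assms(3) by (auto simp: s_def intro: divide_neg_pos)
  have "s \<le> - D / (2 * (\<bar>c\<bar> + 1))" by (simp add: s_def)
  then have "s * (2 * (\<bar>c\<bar> + 1)) \<le> - D" by (subst (asm) pos_le_divide_eq) auto
  moreover have "c * s \<le> s * (\<bar>c\<bar> + 1)" 
    using s mult_left_mono[of c "\<bar>c\<bar> + 1" s] by (simp add: mult.commute)
  ultimately have "D + c * s < 0" using D by (simp add: distrib_left)
  then have "s * (D + c * s) < 0" using s by (simp add: mult_pos_neg)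
  moreover have "0 \<le> quad a b c (z + s)" using assms(1) s by simp
  ultimately show False using quad_at[of a b c "z + s" z] assms(2) by (simp add: D_def)
qed

lemma quad_nonneg_left_zero:
  assumes "\<And>x. \<alpha> \<le> x \<Longrightarrow> x \<le> z \<Longrightarrow> 0 \<le> quad a b c x" "quad a b c z = 0" "\<alpha> < z"
  shows "quad' b c z \<le> 0"
proof -
  have eq: "quad a (- b) c x = quad a b c (- x)" for x by (simp add: quad_def)
  have "0 \<le> quad' (- b) c (- z)"
    by (rule quad_nonneg_right_zero[where \<beta> = "- \<alpha>" and a = a]) (use assms in \<open>auto simp: eq\<close>)
  then show ?thesis by (simp add: quad'_def)
qed

lemma quad_add: "quad (a + a') (b + b') (c + c') x = quad a b c x + quad a' b' c' x"
  and quad_diff: "quad (a - a') (b - b') (c - c') x = quad a b c x - quad a' b' c' x"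
  and quad'_add: "quad' (b + b') (c + c') x = quad' b c x + quad' b' c' x"
  and quad'_diff: "quad' (b - b') (c - c') x = quad' b c x - quad' b' c' x"
  by (simp_all add: quad_def quad'_def algebra_simps)

text \<open>The zero \<open>z\<close> of the first quadratic is also a zero of both perturbed ones, which are
  nonnegative; so their slopes at \<open>z\<close> do not have opposite signs. If the unperturbed slope is zero,
  these slopes are opposite numbers, hence zero. At an end point only a one-sided argument is available, but one side suffices.\<close>
lemma perturbation_vanishes_at_contact:
  assumes plus: "\<And>x. \<alpha> \<le> x \<Longrightarrow> x \<le> \<beta> \<Longrightarrow> 0 \<le> quad (a + a') (b + b') (c + c') x"
    and minus: "\<And>x. \<alpha> \<le> x \<Longrightarrow> x \<le> \<beta> \<Longrightarrow> 0 \<le> quad (a - a') (b - b') (c - c') x"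
    and z: "\<alpha> \<le> z" "z \<le> \<beta>" "\<alpha> < \<beta>" "quad a b c z = 0"
  shows "quad a' b' c' z = 0" "quad' b c z = 0 \<Longrightarrow> quad' b' c' z = 0"
proof -
  show 0: "quad a' b' c' z = 0"
    using plus[of z] minus[of z] z by (simp add: quad_add quad_diff)
  have zeros: "quad (a + a') (b + b') (c + c') z = 0" "quad (a - a') (b - b') (c - c') z = 0"
    using z 0 by (simp_all add: quad_add quad_diff)
  assume 1: "quad' b c z = 0"
  have "z < \<beta> \<or> \<alpha> < z" using z by linarith
  then show "quad' b' c' z = 0"
  proof
    assume "z < \<beta>"
    have "0 \<le> quad' (b + b') (c + c') z"
      by (rule quad_nonneg_right_zero[OF _ zeros(1) \<open>z < \<beta>\<close>], rule plus) (use z in linarith)+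
    moreover have "0 \<le> quad' (b - b') (c - c') z"
      by (rule quad_nonneg_right_zero[OF _ zeros(2) \<open>z < \<beta>\<close>], rule minus) (use z in linarith)+
    ultimately show ?thesis using 1 by (simp add: quad'_add quad'_diff)
  next
    assume "\<alpha> < z"
    have "quad' (b + b') (c + c') z \<le> 0"
      by (rule quad_nonneg_left_zero[OF _ zeros(1) \<open>\<alpha> < z\<close>], rule plus) (use z in linarith)+
    moreover have "quad' (b - b') (c - c') z \<le> 0"
      by (rule quad_nonneg_left_zero[OF _ zeros(2) \<open>\<alpha> < z\<close>], rule minus) (use z in linarith)+
    ultimately show ?thesis using 1 by (simp add: quad'_add quad'_diff)
  qed
qed

text \<open>Near \<open>z\<close> the quotient of \<open>e\<close> and \<open>R\<close> is continuous, hence bounded.\<close>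
lemma locally_dominated:
  fixes R e :: "real \<Rightarrow> real"
  assumes "isCont R z" "isCont e z" "R z \<noteq> 0"
  shows "\<exists>\<delta>>0. \<exists>K\<ge>0. \<forall>x. \<bar>x - z\<bar> < \<delta> \<longrightarrow> \<bar>e x\<bar> \<le> K * \<bar>R x\<bar>"
proof -
  have R: "((\<lambda>x. \<bar>R x\<bar>) \<longlongrightarrow> \<bar>R z\<bar>) (nhds z)" and e: "((\<lambda>x. \<bar>e x\<bar>) \<longlongrightarrow> \<bar>e z\<bar>) (nhds z)"
    using assms by (auto intro!: tendsto_rabs simp: isCont_def tendsto_at_iff_tendsto_nhds)
  have "\<forall>\<^sub>F x in nhds z. \<bar>R z\<bar> / 2 < \<bar>R x\<bar>"
    using assms(3) by (intro order_tendstoD(1)[OF R]) simp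
  moreover have "\<forall>\<^sub>F x in nhds z. \<bar>e x\<bar> < \<bar>e z\<bar> + 1"
    by (intro order_tendstoD(2)[OF e]) simp
  ultimately have "\<forall>\<^sub>F x in nhds z. \<bar>R z\<bar> / 2 < \<bar>R x\<bar> \<and> \<bar>e x\<bar> < \<bar>e z\<bar> + 1"
    by (rule eventually_conj)
  then obtain \<delta> where \<delta>: "\<delta> > 0"
    "\<And>x. \<bar>x - z\<bar> < \<delta> \<Longrightarrow> \<bar>R z\<bar> / 2 < \<bar>R x\<bar> \<and> \<bar>e x\<bar> < \<bar>e z\<bar> + 1"
    unfolding eventually_nhds_metric by (auto simp: dist_real_def)
  define K where "K = (\<bar>e z\<bar> + 1) / (\<bar>R z\<bar> / 2)"
  have K: "K \<ge> 0" by (simp add: K_def)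
  have "\<bar>e x\<bar> \<le> K * \<bar>R x\<bar>" if "\<bar>x - z\<bar> < \<delta>" for x
  proof -
    have "\<bar>e x\<bar> \<le> K * (\<bar>R z\<bar> / 2)" using \<delta>(2)[OF that] assms(3) by (simp add: K_def)
    also have "\<dots> \<le> K * \<bar>R x\<bar>" using \<delta>(2)[OF that] K by (intro mult_left_mono) auto
    finally show ?thesis .
  qed
  with \<delta>(1) K show ?thesis by blast
qed

text \<open>Compactness reduces the claim to a bound near each point \<open>z\<close>. Splitting off the common factor
  \<open>(x - z)^n\<close>, where \<open>n\<close> is the order of the zero of \<open>quad a b c\<close> at \<open>z\<close>, leaves a quotient whose
  denominator does not vanish at \<open>z\<close>.\<close>
lemma dominated_by_quad:
  assumes nonneg: "\<And>x. \<alpha> \<le> x \<Longrightarrow> x \<le> \<beta> \<Longrightarrow> 0 \<le> quad a b c x"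
    and nz: "(a, b, c) \<noteq> (0, 0, 0)" and "\<alpha> \<le> \<beta>"
    and zero: "\<And>z. \<alpha> \<le> z \<Longrightarrow> z \<le> \<beta> \<Longrightarrow> quad a b c z = 0 \<Longrightarrow>
      quad a' b' c' z = 0 \<and> (quad' b c z = 0 \<longrightarrow> quad' b' c' z = 0)"
  shows "\<exists>K\<ge>0. \<forall>x\<in>{\<alpha>..\<beta>}. \<bar>quad a' b' c' x\<bar> \<le> K * quad a b c x"
proof -
  define Q where "Q u v \<longleftrightarrow>
    (\<exists>K\<ge>0. \<forall>x\<in>{u..v} \<inter> {\<alpha>..\<beta>}. \<bar>quad a' b' c' x\<bar> \<le> K * quad a b c x)" for u v
  \<comment> \<open>The bound is additive over adjacent intervals, so bisection yields it on the whole interval.\<close>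
  have "Q \<alpha> \<beta>"
  proof (rule Bolzano[OF \<open>\<alpha> \<le> \<beta>\<close>])
    fix u v w assume "Q u v" "Q v w"
    then obtain K L where "K \<ge> 0" "L \<ge> 0"
      and K: "\<And>x. x \<in> {u..v} \<inter> {\<alpha>..\<beta>} \<Longrightarrow> \<bar>quad a' b' c' x\<bar> \<le> K * quad a b c x"
      and L: "\<And>x. x \<in> {v..w} \<inter> {\<alpha>..\<beta>} \<Longrightarrow> \<bar>quad a' b' c' x\<bar> \<le> L * quad a b c x"
      unfolding Q_def by blast
    have "\<bar>quad a' b' c' x\<bar> \<le> (K + L) * quad a b c x" if "x \<in> {u..w} \<inter> {\<alpha>..\<beta>}" for x
    proof -
      have "0 \<le> K * quad a b c x" "0 \<le> L * quad a b c x"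
        using that nonneg \<open>K \<ge> 0\<close> \<open>L \<ge> 0\<close> by auto
      then show ?thesis using K[of x] L[of x] that by (cases "x \<le> v") (auto simp: distrib_right)
    qed
    then show "Q u w" unfolding Q_def using \<open>K \<ge> 0\<close> \<open>L \<ge> 0\<close> by (intro exI[of _ "K + L"]) auto
  next
    fix z assume z: "\<alpha> \<le> z" "z \<le> \<beta>"
    have "\<exists>\<delta>>0. \<exists>K\<ge>0. \<forall>x. \<bar>x - z\<bar> < \<delta> \<longrightarrow> \<bar>quad a' b' c' x\<bar> \<le> K * \<bar>quad a b c x\<bar>"
    proof (cases "quad a b c z = 0")
      case False
      then show ?thesis
        by (intro locally_dominated) (auto simp: quad_def intro!: continuous_intros)
    next
      case True
      note d0 = zero[OF z True]
      have factor: "quad a b c x = (x - z) * (quad' b c z + c * (x - z))"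
        "quad a' b' c' x = (x - z) * (quad' b' c' z + c' * (x - z))" for x
        using True d0 quad_at[of a b c x z] quad_at[of a' b' c' x z] by simp_all
      show ?thesis
      proof (cases "quad' b c z = 0")
        case False
        have "\<exists>\<delta>>0. \<exists>K\<ge>0. \<forall>x. \<bar>x - z\<bar> < \<delta> \<longrightarrow>
            \<bar>quad' b' c' z + c' * (x - z)\<bar> \<le> K * \<bar>quad' b c z + c * (x - z)\<bar>"
          using False by (intro locally_dominated) (auto intro!: continuous_intros)
        then obtain \<delta> K where "\<delta> > 0" "K \<ge> 0" and
          K: "\<And>x. \<bar>x - z\<bar> < \<delta> \<Longrightarrow>
            \<bar>quad' b' c' z + c' * (x - z)\<bar> \<le> K * \<bar>quad' b c z + c * (x - z)\<bar>"
          by blast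
        have "\<bar>quad a' b' c' x\<bar> \<le> K * \<bar>quad a b c x\<bar>" if "\<bar>x - z\<bar> < \<delta>" for x
        proof -
          have "\<bar>x - z\<bar> * \<bar>quad' b' c' z + c' * (x - z)\<bar>
              \<le> \<bar>x - z\<bar> * (K * \<bar>quad' b c z + c * (x - z)\<bar>)"
            by (intro mult_left_mono K that) simp
          then show ?thesis unfolding factor abs_mult by (simp only: mult.left_commute)
        qed
        with \<open>\<delta> > 0\<close> \<open>K \<ge> 0\<close> show ?thesis by blast
      next
        case D: True
        have "c \<noteq> 0" using D True nz by (auto simp: quad_def quad'_def)
        then have "\<forall>x. \<bar>quad a' b' c' x\<bar> \<le> \<bar>c' / c\<bar> * \<bar>quad a b c x\<bar>"
          using D d0 unfolding factor by (simp add: abs_mult mult.left_commute)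
        then show ?thesis by (intro exI[of _ 1] conjI exI[of _ "\<bar>c' / c\<bar>"]) auto
      qed
    qed
    then obtain \<delta> K where "\<delta> > 0" "K \<ge> 0"
      and K: "\<And>x. \<bar>x - z\<bar> < \<delta> \<Longrightarrow> \<bar>quad a' b' c' x\<bar> \<le> K * \<bar>quad a b c x\<bar>"
      by blast
    have "Q u v" if "u \<le> z \<and> z \<le> v \<and> v - u < \<delta>" for u v
      unfolding Q_def
    proof (intro exI[of _ K] conjI ballI)
      fix x assume "x \<in> {u..v} \<inter> {\<alpha>..\<beta>}"
      then show "\<bar>quad a' b' c' x\<bar> \<le> K * quad a b c x"
        using K[of x] nonneg[of x] that by (auto simp: abs_less_iff)
    qed fact
    then show "\<exists>\<delta>>0. \<forall>u v. u \<le> z \<and> z \<le> v \<and> v - u < \<delta> \<longrightarrow> Q u v"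
      using \<open>\<delta> > 0\<close> by blast
  qed
  then show ?thesis by (simp add: Q_def)
qed

section \<open>The normalised ball and its contact points\<close>

text \<open>Both quadratics have the same coefficients, in opposite order: \<open>quad a b c y\<close> is the value of the
  form at height \<open>y\<close> of the right edge, and \<open>quad c b a u\<close> its value on the top edge.\<close>
definition normal_ball :: "real \<Rightarrow> (real \<times> real \<times> real) set" where
  "normal_ball r = {(a, b, c). (\<forall>y\<in>{0..1}. \<bar>quad a b c y\<bar> \<le> 1) \<and> (\<forall>u\<in>{r..1}. \<bar>quad c b a u\<bar> \<le> 1)}"

lemma normal_ballI:
  assumes "\<And>y. 0 \<le> y \<Longrightarrow> y \<le> 1 \<Longrightarrow> - 1 \<le> quad a b c y \<and> quad a b c y \<le> 1"
    and "\<And>u. r \<le> u \<Longrightarrow> u \<le> 1 \<Longrightarrow> - 1 \<le> quad c b a u \<and> quad c b a u \<le> 1"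
  shows "(a, b, c) \<in> normal_ball r"
  using assms by (fastforce simp: normal_ball_def abs_le_iff)

lemma normal_ballD:
  assumes "(a, b, c) \<in> normal_ball r"
  shows "0 \<le> y \<Longrightarrow> y \<le> 1 \<Longrightarrow> - 1 \<le> quad a b c y"
    and "0 \<le> y \<Longrightarrow> y \<le> 1 \<Longrightarrow> quad a b c y \<le> 1"
    and "r \<le> u \<Longrightarrow> u \<le> 1 \<Longrightarrow> - 1 \<le> quad c b a u"
    and "r \<le> u \<Longrightarrow> u \<le> 1 \<Longrightarrow> quad c b a u \<le> 1"
  using assms by (fastforce simp: normal_ball_def abs_le_iff)+

lemma convex_normal_ball: "convex (normal_ball r)"
proof (rule convexI)
  fix p q :: "real \<times> real \<times> real" and s t :: real
  assume pq: "p \<in> normal_ball r" "q \<in> normal_ball r" and st: "0 \<le> s" "0 \<le> t" "s + t = 1"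
  obtain a b c a' b' c' where [simp]: "p = (a, b, c)" "q = (a', b', c')" by (cases p, cases q) auto
  have bound: "\<bar>s * v + t * w\<bar> \<le> 1" if "\<bar>v\<bar> \<le> 1" "\<bar>w\<bar> \<le> 1" for v w :: real
  proof -
    have "\<bar>s * v + t * w\<bar> \<le> s * \<bar>v\<bar> + t * \<bar>w\<bar>" 
      using st abs_triangle_ineq[of "s * v" "t * w"] by (simp add: abs_mult)
    also have "\<dots> \<le> s * 1 + t * 1" using st that by (intro add_mono mult_left_mono) auto
    finally show ?thesis using st by simp
  qed
  have eq: "quad (s * a + t * a') (s * b + t * b') (s * c + t * c') x = s * quad a b c x + t * quad a' b' c' x"
    for a b c a' b' c' x by (simp add: quad_def algebra_simps)
  show "s *\<^sub>R p + t *\<^sub>R q \<in> normal_ball r"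
    using pq by (auto simp: normal_ball_def eq intro!: bound)
qed

lemma uminus_normal_ball: "- p \<in> normal_ball r \<longleftrightarrow> p \<in> normal_ball r"
proof -
  have "quad (- a) (- b) (- c) x = - quad a b c x" for a b c x by (simp add: quad_def)
  then show ?thesis by (cases p) (simp add: normal_ball_def)
qed

lemma ext_normal_ball_iff:
  "p \<in> ext (normal_ball r) \<longleftrightarrow>
    p \<in> normal_ball r \<and> (\<forall>d. p + d \<in> normal_ball r \<and> p - d \<in> normal_ball r \<longrightarrow> d = 0)"
  by (rule ext_iff_rigid[OF convex_normal_ball])

lemma uminus_ext_normal_ball: "- p \<in> ext (normal_ball r) \<longleftrightarrow> p \<in> ext (normal_ball r)"
proof -
  have "- p + d \<in> normal_ball r \<longleftrightarrow> p - d \<in> normal_ball r"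
    "- p - d \<in> normal_ball r \<longleftrightarrow> p + d \<in> normal_ball r" for d
  proof -
    have "- p + d = - (p - d)" "- p - d = - (p + d)" by simp_all
    then show "- p + d \<in> normal_ball r \<longleftrightarrow> p - d \<in> normal_ball r"
      "- p - d \<in> normal_ball r \<longleftrightarrow> p + d \<in> normal_ball r"
      by (simp_all only: uminus_normal_ball)
  qed
  then show ?thesis by (auto simp: ext_normal_ball_iff uminus_normal_ball)
qed

text \<open>Both \<open>1 - quad a b c\<close> and \<open>1 + quad a b c\<close> are nonnegative quadratics, and the contacts are their
  zeros; the smaller of the two is the gap \<open>1 - \<bar>quad a b c\<bar>\<close>.\<close>
lemma dominated_by_both_gaps:
  assumes bound: "\<And>x. \<alpha> \<le> x \<Longrightarrow> x \<le> \<beta> \<Longrightarrow> - 1 \<le> quad a b c x \<and> quad a b c x \<le> 1"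
    and nonconst: "(b, c) \<noteq> (0, 0) \<or> \<bar>a\<bar> \<noteq> 1" and "\<alpha> \<le> \<beta>"
    and contact: "\<And>z. \<alpha> \<le> z \<Longrightarrow> z \<le> \<beta> \<Longrightarrow> \<bar>quad a b c z\<bar> = 1 \<Longrightarrow>
      quad a' b' c' z = 0 \<and> (quad' b c z = 0 \<longrightarrow> quad' b' c' z = 0)"
  shows "\<exists>K\<ge>0. \<forall>x\<in>{\<alpha>..\<beta>}. \<bar>quad a' b' c' x\<bar> \<le> K * (1 - \<bar>quad a b c x\<bar>)"
proof -
  have up: "quad (1 - a) (- b) (- c) x = 1 - quad a b c x" "quad' (- b) (- c) x = - quad' b c x"
   and lo: "quad (1 + a) b c x = 1 + quad a b c x" for x
    by (simp_all add: quad_def quad'_def)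
  have "\<exists>K\<ge>0. \<forall>x\<in>{\<alpha>..\<beta>}. \<bar>quad a' b' c' x\<bar> \<le> K * quad (1 - a) (- b) (- c) x"
  proof (rule dominated_by_quad)
    show "0 \<le> quad (1 - a) (- b) (- c) x" if "\<alpha> \<le> x" "x \<le> \<beta>" for x
      using bound[OF that] by (simp add: up)
    show "(1 - a, - b, - c) \<noteq> (0, 0, 0)" using nonconst by auto
    fix z assume z: "\<alpha> \<le> z" "z \<le> \<beta>" "quad (1 - a) (- b) (- c) z = 0"
    then have "quad a b c z = 1" by (simp add: up)
    then show "quad a' b' c' z = 0 \<and> (quad' (- b) (- c) z = 0 \<longrightarrow> quad' b' c' z = 0)"
      using contact[OF z(1,2)] by (simp add: up)
  qed fact
  then obtain K where K: "K \<ge> 0" "\<And>x. x \<in> {\<alpha>..\<beta>} \<Longrightarrow> \<bar>quad a' b' c' x\<bar> \<le> K * (1 - quad a b c x)"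
    by (auto simp: up)
  have "\<exists>L\<ge>0. \<forall>x\<in>{\<alpha>..\<beta>}. \<bar>quad a' b' c' x\<bar> \<le> L * quad (1 + a) b c x"
  proof (rule dominated_by_quad)
    show "0 \<le> quad (1 + a) b c x" if "\<alpha> \<le> x" "x \<le> \<beta>" for x using bound[OF that] by (simp add: lo)
    show "(1 + a, b, c) \<noteq> (0, 0, 0)" using nonconst by auto
    fix z assume z: "\<alpha> \<le> z" "z \<le> \<beta>" "quad (1 + a) b c z = 0"
    then have "quad a b c z = - 1" by (simp add: lo)
    then show "quad a' b' c' z = 0 \<and> (quad' b c z = 0 \<longrightarrow> quad' b' c' z = 0)"
      using contact[OF z(1,2)] by simp
  qed fact
  then obtain L where L: "L \<ge> 0" "\<And>x. x \<in> {\<alpha>..\<beta>} \<Longrightarrow> \<bar>quad a' b' c' x\<bar> \<le> L * (1 + quad a b c x)"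
    by (auto simp: lo)
  have "\<bar>quad a' b' c' x\<bar> \<le> (K + L) * (1 - \<bar>quad a b c x\<bar>)" if x: "x \<in> {\<alpha>..\<beta>}" for x
  proof -
    have "0 \<le> K * (1 - \<bar>quad a b c x\<bar>)" "0 \<le> L * (1 - \<bar>quad a b c x\<bar>)"
      using K(1) L(1) bound[of x] x by (auto simp: abs_le_iff)
    then show ?thesis using K(2)[OF x] L(2)[OF x]
      by (cases "0 \<le> quad a b c x") (auto simp: distrib_right)
  qed
  then show ?thesis using K(1) L(1) by (intro exI[of _ "K + L"]) auto
qed

text \<open>The tool for excluding extremality: whenever a nonzero quadratic \<open>d\<close> is chosen, an extreme point
  must have a contact at which \<open>d\<close> fails to vanish to the required order. In the applications \<open>d\<close>
  vanishes, by design, at all contacts but the one to be found. The hypotheses exclude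
  constant modulus \<open>1\<close> on an edge, where every point would be a contact.\<close>
lemma extreme_contact:
  assumes ext: "(a, b, c) \<in> ext (normal_ball r)" and r: "r < 1"
    and nf: "(b, c) \<noteq> (0, 0) \<or> \<bar>a\<bar> \<noteq> 1" and ng: "(b, a) \<noteq> (0, 0) \<or> \<bar>c\<bar> \<noteq> 1"
    and d: "(a', b', c') \<noteq> (0, 0, 0)"
  obtains (f) y where "0 \<le> y" "y \<le> 1" "\<bar>quad a b c y\<bar> = 1"
      "quad a' b' c' y \<noteq> 0 \<or> quad' b c y = 0 \<and> quad' b' c' y \<noteq> 0"
  | (g) u where "r \<le> u" "u \<le> 1" "\<bar>quad c b a u\<bar> = 1"
      "quad c' b' a' u \<noteq> 0 \<or> quad' b a u = 0 \<and> quad' b' a' u \<noteq> 0"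
proof (rule ccontr)
  \<comment> \<open>Otherwise \<open>(a', b', c')\<close> is dominated by the gaps, and adding or subtracting a small multiple
    \<open>e\<close> of it stays in the ball.\<close>
  assume no: "\<not> thesis"
  have ball: "(a, b, c) \<in> normal_ball r"
    and rigid: "\<And>d. (a, b, c) + d \<in> normal_ball r \<Longrightarrow> (a, b, c) - d \<in> normal_ball r \<Longrightarrow> d = 0"
    using ext unfolding ext_normal_ball_iff by blast+
  note bounds = normal_ballD[OF ball]
  have K_ex: "\<exists>K\<ge>0. \<forall>x\<in>{0..1}. \<bar>quad a' b' c' x\<bar> \<le> K * (1 - \<bar>quad a b c x\<bar>)"
  proof (rule dominated_by_both_gaps[OF _ nf])
    show "- 1 \<le> quad a b c x \<and> quad a b c x \<le> 1" if "0 \<le> x" "x \<le> 1" for x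
      using bounds(1,2) that by blast
    show "quad a' b' c' z = 0 \<and> (quad' b c z = 0 \<longrightarrow> quad' b' c' z = 0)"
      if "0 \<le> z" "z \<le> 1" "\<bar>quad a b c z\<bar> = 1" for z
      using f[OF that] no by blast
  qed simp
  have L_ex: "\<exists>L\<ge>0. \<forall>x\<in>{r..1}. \<bar>quad c' b' a' x\<bar> \<le> L * (1 - \<bar>quad c b a x\<bar>)"
  proof (rule dominated_by_both_gaps[OF _ ng])
    show "- 1 \<le> quad c b a x \<and> quad c b a x \<le> 1" if "r \<le> x" "x \<le> 1" for x
      using bounds(3,4) that by blast
    show "quad c' b' a' z = 0 \<and> (quad' b a z = 0 \<longrightarrow> quad' b' a' z = 0)"
      if "r \<le> z" "z \<le> 1" "\<bar>quad c b a z\<bar> = 1" for z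
      using g[OF that] no by blast
  qed (use r in simp)
  from K_ex obtain K where "K \<ge> 0"
    and K: "\<And>x. x \<in> {0..1} \<Longrightarrow> \<bar>quad a' b' c' x\<bar> \<le> K * (1 - \<bar>quad a b c x\<bar>)"
    by metis
  from L_ex obtain L where "L \<ge> 0"
    and L: "\<And>x. x \<in> {r..1} \<Longrightarrow> \<bar>quad c' b' a' x\<bar> \<le> L * (1 - \<bar>quad c b a x\<bar>)"
    by metis
  define e where "e = 1 / (K + L + 1)"
  have e: "e > 0" "e * K \<le> 1" "e * L \<le> 1" using \<open>K \<ge> 0\<close> \<open>L \<ge> 0\<close> by (simp_all add: e_def)
  have shrink: "\<bar>v + e * w\<bar> \<le> 1 \<and> \<bar>v - e * w\<bar> \<le> 1"
    if "\<bar>w\<bar> \<le> M * (1 - \<bar>v\<bar>)" "e * M \<le> 1" "\<bar>v\<bar> \<le> 1" for v w M :: real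
  proof -
    have "\<bar>e * w\<bar> \<le> e * (M * (1 - \<bar>v\<bar>))"
      unfolding abs_mult using e(1) that(1) by (simp add: mult_left_mono)
    also have "\<dots> = e * M * (1 - \<bar>v\<bar>)" by simp
    also have "\<dots> \<le> 1 * (1 - \<bar>v\<bar>)" using that(2,3) by (intro mult_right_mono) auto
    finally show ?thesis
      using abs_triangle_ineq[of v "e * w"] abs_triangle_ineq4[of v "e * w"] by simp
  qed
  have eq: "quad (a + e * a') (b + e * b') (c + e * c') x = quad a b c x + e * quad a' b' c' x"
    "quad (a - e * a') (b - e * b') (c - e * c') x = quad a b c x - e * quad a' b' c' x"
    for a b c a' b' c' x unfolding quad_def by algebra+
  have "\<bar>quad a b c y + e * quad a' b' c' y\<bar> \<le> 1 \<and> \<bar>quad a b c y - e * quad a' b' c' y\<bar> \<le> 1"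
    if "y \<in> {0..1}" for y
    using bounds(1,2)[of y] that by (intro shrink[OF K[OF that] e(2)]) (simp add: abs_le_iff)
  moreover have "\<bar>quad c b a u + e * quad c' b' a' u\<bar> \<le> 1 \<and> \<bar>quad c b a u - e * quad c' b' a' u\<bar> \<le> 1"
    if "u \<in> {r..1}" for u
    using bounds(3,4)[of u] that by (intro shrink[OF L[OF that] e(3)]) (simp add: abs_le_iff)
  ultimately have "(a, b, c) + (e * a', e * b', e * c') \<in> normal_ball r"
    "(a, b, c) - (e * a', e * b', e * c') \<in> normal_ball r"
    by (simp_all add: normal_ball_def eq)
  from rigid[OF this] have "e * a' = 0" "e * b' = 0" "e * c' = 0" by (simp_all add: zero_prod_def)
  with d e(1) show False by simp
qed

lemma admissible_direction_vanishes_at_contact: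
  assumes plus: "(a, b, c) + (a', b', c') \<in> normal_ball r"
    and minus: "(a, b, c) - (a', b', c') \<in> normal_ball r"
  shows "0 \<le> y \<Longrightarrow> y \<le> 1 \<Longrightarrow> \<bar>quad a b c y\<bar> = 1 \<Longrightarrow>
      quad a' b' c' y = 0 \<and> (quad' b c y = 0 \<longrightarrow> quad' b' c' y = 0)"
    and "r < 1 \<Longrightarrow> r \<le> u \<Longrightarrow> u \<le> 1 \<Longrightarrow> \<bar>quad c b a u\<bar> = 1 \<Longrightarrow>
      quad c' b' a' u = 0 \<and> (quad' b a u = 0 \<longrightarrow> quad' b' a' u = 0)"
proof -
  have low: "quad a' b' c' z = 0 \<and> (quad' b c z = 0 \<longrightarrow> quad' b' c' z = 0)"
    if z: "\<alpha> \<le> z" "z \<le> \<beta>" "\<alpha> < \<beta>" and "quad a b c z = - 1"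
      and P: "\<And>x. \<alpha> \<le> x \<Longrightarrow> x \<le> \<beta> \<Longrightarrow> - 1 \<le> quad (a + a') (b + b') (c + c') x"
      and M: "\<And>x. \<alpha> \<le> x \<Longrightarrow> x \<le> \<beta> \<Longrightarrow> - 1 \<le> quad (a - a') (b - b') (c - c') x"
    for a b c a' b' c' z \<alpha> \<beta>
  proof -
    have p: "0 \<le> quad (1 + a + a') (b + b') (c + c') x"
      and m: "0 \<le> quad (1 + a - a') (b - b') (c - c') x" if "\<alpha> \<le> x" "x \<le> \<beta>" for x
      using P[OF that] M[OF that] by (simp_all add: quad_def)
    have 0: "quad (1 + a) b c z = 0" using \<open>quad a b c z = - 1\<close> by (simp add: quad_def)
    show ?thesis using perturbation_vanishes_at_contact[OF p m z 0] by simp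
  qed
  have neg: "quad (- a) (- b) (- c) x = - quad a b c x" "quad' (- b) (- c) x = - quad' b c x"
    "quad (- a + a') (- b + b') (- c + c') x = - quad (a - a') (b - b') (c - c') x"
    "quad (- a - a') (- b - b') (- c - c') x = - quad (a + a') (b + b') (c + c') x"
    for a b c a' b' c' x unfolding quad_def quad'_def by algebra+
  have gap: "quad a' b' c' z = 0 \<and> (quad' b c z = 0 \<longrightarrow> quad' b' c' z = 0)"
    if z: "\<alpha> \<le> z" "z \<le> \<beta>" "\<alpha> < \<beta>" "\<bar>quad a b c z\<bar> = 1"
      and P: "\<And>x. \<alpha> \<le> x \<Longrightarrow> x \<le> \<beta> \<Longrightarrow> \<bar>quad (a + a') (b + b') (c + c') x\<bar> \<le> 1"
      and M: "\<And>x. \<alpha> \<le> x \<Longrightarrow> x \<le> \<beta> \<Longrightarrow> \<bar>quad (a - a') (b - b') (c - c') x\<bar> \<le> 1"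
    for a b c a' b' c' z \<alpha> \<beta>
  proof -
    have "quad a b c z = - 1 \<or> quad (- a) (- b) (- c) z = - 1" using z(4) unfolding neg by linarith
    then show ?thesis
    proof
      assume *: "quad a b c z = - 1"
      show ?thesis
      proof (rule low[OF z(1-3) *])
        fix x assume "\<alpha> \<le> x" "x \<le> \<beta>"
        note P[OF this] M[OF this]
        then show "- 1 \<le> quad (a + a') (b + b') (c + c') x" "- 1 \<le> quad (a - a') (b - b') (c - c') x"
          by linarith+
      qed
    next
      assume *: "quad (- a) (- b) (- c) z = - 1"
      have "quad a' b' c' z = 0 \<and> (quad' (- b) (- c) z = 0 \<longrightarrow> quad' b' c' z = 0)"
      proof (rule low[OF z(1-3) *])
        fix x assume "\<alpha> \<le> x" "x \<le> \<beta>"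
        note P[OF this] M[OF this]
        then show "- 1 \<le> quad (- a + a') (- b + b') (- c + c') x"
          "- 1 \<le> quad (- a - a') (- b - b') (- c - c') x"
          unfolding neg by linarith+
      qed
      then show ?thesis by (simp add: neg)
    qed
  qed
  show "0 \<le> y \<Longrightarrow> y \<le> 1 \<Longrightarrow> \<bar>quad a b c y\<bar> = 1 \<Longrightarrow>
      quad a' b' c' y = 0 \<and> (quad' b c y = 0 \<longrightarrow> quad' b' c' y = 0)"
    by (rule gap[of 0 _ 1]) (use plus minus in \<open>auto simp: normal_ball_def\<close>)
  show "r < 1 \<Longrightarrow> r \<le> u \<Longrightarrow> u \<le> 1 \<Longrightarrow> \<bar>quad c b a u\<bar> = 1 \<Longrightarrow>
      quad c' b' a' u = 0 \<and> (quad' b a u = 0 \<longrightarrow> quad' b' a' u = 0)"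
    by (rule gap[of r _ 1]) (use plus minus in \<open>auto simp: normal_ball_def\<close>)
qed

section \<open>The families of extreme points\<close>

lemma ext_normal_ballI:
  assumes "(a, b, c) \<in> normal_ball r"
    and "\<And>a' b' c'. (a, b, c) + (a', b', c') \<in> normal_ball r \<Longrightarrow> (a, b, c) - (a', b', c') \<in> normal_ball r \<Longrightarrow>
      a' = 0 \<and> b' = 0 \<and> c' = 0"
  shows "(a, b, c) \<in> ext (normal_ball r)"
  using assms unfolding ext_normal_ball_iff by (force simp: zero_prod_def)

text \<open>These are the parabolas \<open>(w y - s)\<^sup>2 - 1\<close> on the right edge, with vertex \<open>s / w\<close> in \<open>[0, 1]\<close>; on the
  top edge they read \<open>(w - s u)\<^sup>2 - u\<^sup>2\<close>. The last two inequalities state \<open>f 0 \<le> 1\<close> and \<open>g r \<le> 1\<close>,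
  and the disjunction demands equality in one of them.\<close>
definition valley :: "real \<Rightarrow> (real \<times> real \<times> real) set" where
  "valley r = {(s\<^sup>2 - 1, - (2 * s * w), w\<^sup>2) | s w. 0 \<le> s \<and> s \<le> w \<and> s \<le> sqrt 2 \<and>
     w - r * s \<le> sqrt (1 + r\<^sup>2) \<and> (s = sqrt 2 \<or> w - r * s = sqrt (1 + r\<^sup>2))}"

text \<open>These are the parabolas \<open>1 - (v - u)\<^sup>2\<close> on the top edge, with vertex \<open>u\<close> in \<open>[r, 1]\<close>; on the right
  edge they read \<open>y\<^sup>2 - (1 - u y)\<^sup>2\<close>, which equals \<open>-1\<close> at \<open>y = 0\<close>.\<close>
definition ridge :: "real \<Rightarrow> (real \<times> real \<times> real) set" where
  "ridge r = {(- 1, 2 * u, 1 - u\<^sup>2) | u. r \<le> u \<and> u \<le> 1}"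

text \<open>The bounds hold because \<open>\<bar>w y - s\<bar>\<close> is at most \<open>sqrt 2\<close> and \<open>w - s u\<close> is largest at \<open>u = r\<close>. A
  direction must be a multiple of \<open>(y - z)\<^sup>2\<close>, where \<open>z\<close> is the vertex, and this square does not vanish
  at the remaining contact, \<open>y = 0\<close> or \<open>u = r\<close>.\<close>
lemma valley_extreme:
  assumes r: "0 < r" "r < 1" and p: "p \<in> valley r"
  shows "p \<in> ext (normal_ball r)"
proof -
  obtain s w where [simp]: "p = (s\<^sup>2 - 1, - (2 * s * w), w\<^sup>2)" and s: "0 \<le> s" "s \<le> w" "s \<le> sqrt 2"
    and w: "w - r * s \<le> sqrt (1 + r\<^sup>2)" and eq: "s = sqrt 2 \<or> w - r * s = sqrt (1 + r\<^sup>2)"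
    using p unfolding valley_def by blast
  have f: "quad (s\<^sup>2 - 1) (- (2 * s * w)) (w\<^sup>2) y = (w * y - s)\<^sup>2 - 1" for y
    unfolding quad_def by algebra
  have g: "quad (w\<^sup>2) (- (2 * s * w)) (s\<^sup>2 - 1) u = (w - s * u)\<^sup>2 - u\<^sup>2" for u
    unfolding quad_def by algebra
  have "r\<^sup>2 \<le> 1" using r by (simp add: power_le_one)
  have ball: "p \<in> normal_ball r"
    unfolding \<open>p = _\<close>
  proof (rule normal_ballI, unfold f g)
    fix y :: real assume y: "0 \<le> y" "y \<le> 1"
    have "w * y \<le> w * 1" using y s by (intro mult_left_mono) auto
    moreover have "0 \<le> w * y" using y s by simp
    moreover have "r * s \<le> 1 * s" using r s by (intro mult_right_mono) auto
    moreover have "sqrt (1 + r\<^sup>2) \<le> sqrt 2" using \<open>r\<^sup>2 \<le> 1\<close> by simp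
    ultimately have "\<bar>w * y - s\<bar> \<le> sqrt 2" 
      using s w unfolding abs_le_iff by (intro conjI; linarith)
    then have "(w * y - s)\<^sup>2 \<le> (sqrt 2)\<^sup>2" using abs_le_square_iff[of "w * y - s" "sqrt 2"] by simp
    then show "- 1 \<le> (w * y - s)\<^sup>2 - 1 \<and> (w * y - s)\<^sup>2 - 1 \<le> 1" by simp
  next
    fix u assume u: "r \<le> u" "u \<le> 1"
    have "s * u \<le> s * 1" "s * r \<le> s * u" using u s r by (intro mult_left_mono; simp)+
    then have "0 \<le> w - s * u" "w - s * u \<le> sqrt (1 + r\<^sup>2)" using s w by (simp_all add: mult.commute)
    then have "(w - s * u)\<^sup>2 \<le> 1 + r\<^sup>2" using power_mono[of "w - s * u" "sqrt (1 + r\<^sup>2)" 2] by simp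
    moreover have "r\<^sup>2 \<le> u\<^sup>2" "u\<^sup>2 \<le> 1" using u r by (auto intro: power_mono simp: power_le_one)
    moreover have "0 \<le> (w - s * u)\<^sup>2" by simp
    ultimately show "- 1 \<le> (w - s * u)\<^sup>2 - u\<^sup>2 \<and> (w - s * u)\<^sup>2 - u\<^sup>2 \<le> 1" by linarith
  qed
  have "w > 0"
    using eq
  proof
    assume "s = sqrt 2" then show ?thesis using s by (smt (verit) real_sqrt_gt_zero)
  next
    assume *: "w - r * s = sqrt (1 + r\<^sup>2)"
    have "0 < sqrt (1 + r\<^sup>2)" by (simp add: add_pos_nonneg)
    moreover have "0 \<le> r * s" using r s by simp
    ultimately show ?thesis using * by linarith
  qed
  define z where "z = s / w"
  have z: "0 \<le> z" "z \<le> 1" "w * z = s" using s \<open>w > 0\<close> by (simp_all add: z_def)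
  show ?thesis
    unfolding \<open>p = _\<close>
  proof (rule ext_normal_ballI)
    fix a' b' c'
    assume "(s\<^sup>2 - 1, - (2 * s * w), w\<^sup>2) + (a', b', c') \<in> normal_ball r"
      and "(s\<^sup>2 - 1, - (2 * s * w), w\<^sup>2) - (a', b', c') \<in> normal_ball r"
    note C = admissible_direction_vanishes_at_contact[OF this, unfolded f g]
    have "quad' (- (2 * s * w)) (w\<^sup>2) z = 2 * w * (w * z - s)" unfolding quad'_def by algebra
    then have "quad a' b' c' z = 0" "quad' b' c' z = 0" using C(1)[of z] z by simp_all
    then have d: "b' = - 2 * c' * z" "a' = c' * z\<^sup>2"
      by (simp_all add: quad_def quad'_def) algebra+
    have "c' = 0"
      using eq
    proof
      assume "s = sqrt 2"
      then have "quad a' b' c' 0 = 0" using C(1)[of 0] by simp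
      moreover have "z \<noteq> 0" using z(3) \<open>s = sqrt 2\<close> by auto
      ultimately show ?thesis using d(2) by (simp add: quad_def)
    next
      assume *: "w - r * s = sqrt (1 + r\<^sup>2)"
      then have "(w - s * r)\<^sup>2 = 1 + r\<^sup>2" by (simp add: mult.commute)
      then have "quad c' b' a' r = 0" using C(2)[of r] r by simp
      moreover have "quad c' b' a' r = c' * (1 - r * z)\<^sup>2" unfolding quad_def d by algebra
      moreover have "r * z \<le> r * 1" using z r by (intro mult_left_mono) auto
      then have "1 - r * z \<noteq> 0" using r by linarith
      ultimately show ?thesis by simp
    qed
    then show "a' = 0 \<and> b' = 0 \<and> c' = 0" using d by simp
  qed (use ball in simp)
qed

text \<open>A direction must be a multiple of \<open>(v - u)\<^sup>2\<close> on the top edge, hence of \<open>(1 - u y)\<^sup>2\<close> on the right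
  edge, and the latter does not vanish at the contact \<open>y = 0\<close>.\<close>
lemma ridge_extreme:
  assumes r: "0 < r" "r < 1" and p: "p \<in> ridge r"
  shows "p \<in> ext (normal_ball r)"
proof -
  obtain u where [simp]: "p = (- 1, 2 * u, 1 - u\<^sup>2)" and u: "r \<le> u" "u \<le> 1"
    using p unfolding ridge_def by blast
  have f: "quad (- 1) (2 * u) (1 - u\<^sup>2) y = y\<^sup>2 - (1 - u * y)\<^sup>2" for y
    unfolding quad_def by algebra
  have g: "quad (1 - u\<^sup>2) (2 * u) (- 1) v = 1 - (v - u)\<^sup>2" for v
    unfolding quad_def by algebra
  show ?thesis
    unfolding \<open>p = _\<close>
  proof (rule ext_normal_ballI)
    show "(- 1, 2 * u, 1 - u\<^sup>2) \<in> normal_ball r"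
    proof (rule normal_ballI, unfold f g)
      fix y :: real assume y: "0 \<le> y" "y \<le> 1"
      have "0 \<le> u * y" "u * y \<le> 1" using y u r by (auto intro: mult_le_one)
      then have "(1 - u * y)\<^sup>2 \<le> 1" by (simp add: power_le_one)
      moreover have "y\<^sup>2 \<le> 1" using y by (simp add: power_le_one)
      moreover have "0 \<le> y\<^sup>2" "0 \<le> (1 - u * y)\<^sup>2" by simp_all
      ultimately show "- 1 \<le> y\<^sup>2 - (1 - u * y)\<^sup>2 \<and> y\<^sup>2 - (1 - u * y)\<^sup>2 \<le> 1" by linarith
    next
      fix v assume "r \<le> v" "v \<le> 1"
      then have "(v - u)\<^sup>2 \<le> 1" using u r by (simp add: abs_square_le_1 abs_le_iff)
      then show "- 1 \<le> 1 - (v - u)\<^sup>2 \<and> 1 - (v - u)\<^sup>2 \<le> 1" by simp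
    qed
    fix a' b' c'
    assume "(- 1, 2 * u, 1 - u\<^sup>2) + (a', b', c') \<in> normal_ball r"
      and "(- 1, 2 * u, 1 - u\<^sup>2) - (a', b', c') \<in> normal_ball r"
    note C = admissible_direction_vanishes_at_contact[OF this, unfolded f g]
    have "quad' (2 * u) (- 1) u = 0" by (simp add: quad'_def)
    then have "quad c' b' a' u = 0" "quad' b' a' u = 0" using C(2)[of u] u r by simp_all
    moreover have "quad a' b' c' 0 = 0" using C(1)[of 0] by simp
    ultimately show "a' = 0 \<and> b' = 0 \<and> c' = 0" by (simp add: quad_def quad'_def)
  qed
qed

text \<open>One edge consists of contacts only, so a direction vanishes identically; two tangential
  contacts are enough to see it.\<close>
lemma square_monomials_extreme:
  assumes "0 < r" "r < 1"
  shows "(1, 0, 0) \<in> ext (normal_ball r)" "(0, 0, 1) \<in> ext (normal_ball r)"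
proof -
  have sq: "u\<^sup>2 \<le> 1" if "0 \<le> u" "u \<le> 1" for u :: real using that by (simp add: power_le_one)
  show "(1, 0, 0) \<in> ext (normal_ball r)"
  proof (rule ext_normal_ballI)
    show "(1, 0, 0) \<in> normal_ball r"
      by (rule normal_ballI) (use assms sq in \<open>auto simp: quad_def intro: order_trans[of _ 0]\<close>)
    fix a' b' c' assume "(1, 0, 0) + (a', b', c') \<in> normal_ball r" "(1, 0, 0) - (a', b', c') \<in> normal_ball r"
    note C = admissible_direction_vanishes_at_contact(1)[OF this]
    show "a' = 0 \<and> b' = 0 \<and> c' = 0"
      using C[of 0] C[of 1] by (simp add: quad_def quad'_def)
  qed
  show "(0, 0, 1) \<in> ext (normal_ball r)"
  proof (rule ext_normal_ballI)
    show "(0, 0, 1) \<in> normal_ball r"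
      by (rule normal_ballI) (use assms sq in \<open>auto simp: quad_def intro: order_trans[of _ 0]\<close>)
    fix a' b' c' assume "(0, 0, 1) + (a', b', c') \<in> normal_ball r" "(0, 0, 1) - (a', b', c') \<in> normal_ball r"
    note C = admissible_direction_vanishes_at_contact(2)[OF this]
    have "c' + b' * r + a' * r\<^sup>2 = 0" "b' + 2 * a' * r = 0" "c' + b' + a' = 0" "b' + 2 * a' = 0"
      using C[of r] C[of 1] assms by (simp_all add: quad_def quad'_def)
    moreover from this have "a' * (1 - r) = 0" by algebra
    ultimately show "a' = 0 \<and> b' = 0 \<and> c' = 0" using assms by simp
  qed
qed

text \<open>A quadratic with the three zeros \<open>0\<close>, \<open>1\<close> and \<open>1 / r\<close> is zero.\<close>
lemma corner_contacts_extreme: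
  assumes ball: "(a, b, c) \<in> normal_ball r" and r: "0 < r" "r < 1"
    and "\<bar>quad a b c 0\<bar> = 1" "\<bar>quad a b c 1\<bar> = 1" "\<bar>quad c b a r\<bar> = 1"
  shows "(a, b, c) \<in> ext (normal_ball r)"
proof (rule ext_normal_ballI[OF ball])
  fix a' b' c' assume "(a, b, c) + (a', b', c') \<in> normal_ball r" "(a, b, c) - (a', b', c') \<in> normal_ball r"
  note C = admissible_direction_vanishes_at_contact[OF this]
  have "a' = 0" "a' + b' + c' = 0" "c' + b' * r + a' * r\<^sup>2 = 0"
    using C(1)[of 0] C(1)[of 1] C(2)[of r] assms by (auto simp: quad_def)
  moreover from this have "c' * (1 - r) = 0" by algebra
  ultimately show "a' = 0 \<and> b' = 0 \<and> c' = 0" using r by simp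
qed

text \<open>By \<open>corner_contacts_extreme\<close> only membership in the ball is at issue. It follows from
  factorisations of \<open>1 - f\<close>, \<open>1 + f\<close>, \<open>1 - g\<close> and \<open>1 + g\<close> through their known zeros. For the second point
  the hypothesis on \<open>r\<close> amounts to \<open>c < 2\<close>, which keeps \<open>f\<close> above \<open>-1\<close> on the left of \<open>y = 1\<close>.\<close>
lemma corner_points_extreme:
  assumes r: "0 < r" "r < 1"
  shows "(1, - (1 + r), 1 + r) \<in> ext (normal_ball r)"
    and "r\<^sup>2 - 4 * r + 1 > 0 \<Longrightarrow>
      (1, - ((3 - r\<^sup>2) / (1 - r)), (3 - r\<^sup>2) / (1 - r) - 2) \<in> ext (normal_ball r)"
proof -
  show "(1, - (1 + r), 1 + r) \<in> ext (normal_ball r)"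
  proof (rule corner_contacts_extreme[OF _ r])
    have f: "quad 1 (- (1 + r)) (1 + r) y = 1 - (1 + r) * (y * (1 - y))" for y
      by (simp add: quad_def algebra_simps power2_eq_square)
    have g: "quad (1 + r) (- (1 + r)) 1 u = 1 - (1 - u) * (u - r)" for u
      by (simp add: quad_def algebra_simps power2_eq_square)
    show "(1, - (1 + r), 1 + r) \<in> normal_ball r"
    proof (rule normal_ballI, unfold f g)
      fix y :: real assume y: "0 \<le> y" "y \<le> 1"
      have "0 \<le> y * (1 - y)" "y * (1 - y) \<le> 1" using y by (auto intro: mult_le_one)
      then have "(1 + r) * (y * (1 - y)) \<le> 2 * 1" using r by (intro mult_mono) auto
      moreover have "0 \<le> (1 + r) * (y * (1 - y))" using r y by simp
      ultimately show "- 1 \<le> 1 - (1 + r) * (y * (1 - y)) \<and> 1 - (1 + r) * (y * (1 - y)) \<le> 1"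
        by linarith
    next
      fix u assume "r \<le> u" "u \<le> 1"
      then have "0 \<le> (1 - u) * (u - r)" "(1 - u) * (u - r) \<le> 1" using r by (auto intro: mult_le_one)
      then show "- 1 \<le> 1 - (1 - u) * (u - r) \<and> 1 - (1 - u) * (u - r) \<le> 1" by simp
    qed
  qed (simp_all add: quad_def power2_eq_square algebra_simps)
next
  assume pos: "r\<^sup>2 - 4 * r + 1 > 0"
  define c where "c = (3 - r\<^sup>2) / (1 - r) - 2"
  have cr: "c * (1 - r) = 1 + 2 * r - r\<^sup>2" using r by (simp add: c_def field_simps)
  have "c \<le> 2"
  proof (rule ccontr)
    assume "\<not> c \<le> 2"
    then have "2 * (1 - r) < c * (1 - r)" using r by (intro mult_strict_right_mono) auto
    with cr pos show False by simp
  qed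
  have "1 + r < c"
  proof (rule ccontr)
    assume "\<not> 1 + r < c"
    then have "c * (1 - r) \<le> (1 + r) * (1 - r)" using r by (intro mult_right_mono) auto
    also have "\<dots> = 1 - r\<^sup>2" by algebra
    finally show False using cr r by simp
  qed
  have f: "quad 1 (- (c + 2)) c y = 1 - 2 * y - c * (y * (1 - y))"
    "quad 1 (- (c + 2)) c y = (1 - y) * (2 - c * y) - 1" for y
    by (simp_all add: quad_def algebra_simps power2_eq_square)
  have g: "quad c (- (c + 2)) 1 u = (1 - u) * (c + 1 - u) - 1" for u
    by (simp add: quad_def algebra_simps power2_eq_square)
  have g': "(1 - u) * (c + 1 - u) - 1 = 1 - (u - r) * (c + 2 - r - u)" for u
    using cr by algebra
  have "(1, - (c + 2), c) \<in> ext (normal_ball r)"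
  proof (rule corner_contacts_extreme[OF _ r])
    show "(1, - (c + 2), c) \<in> normal_ball r"
    proof (intro normal_ballI conjI)
      fix y :: real assume y: "0 \<le> y" "y \<le> 1"
      have "0 \<le> c * (y * (1 - y))" using y \<open>1 + r < c\<close> r by simp
      then show "quad 1 (- (c + 2)) c y \<le> 1" unfolding f(1) using y by linarith
      have "c * y \<le> 2 * 1" using y \<open>c \<le> 2\<close> by (intro mult_mono) auto
      then show "- 1 \<le> quad 1 (- (c + 2)) c y" unfolding f(2) using y by simp
    next
      fix u assume u: "r \<le> u" "u \<le> 1"
      show "- 1 \<le> quad c (- (c + 2)) 1 u" unfolding g using u \<open>1 + r < c\<close> r by simp
      show "quad c (- (c + 2)) 1 u \<le> 1" unfolding g g' using u \<open>1 + r < c\<close> r by simp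
    qed
    show "\<bar>quad c (- (c + 2)) 1 r\<bar> = 1" unfolding g g' by simp
  qed (simp_all add: quad_def)
  moreover have "c + 2 = (3 - r\<^sup>2) / (1 - r)" by (simp add: c_def)
  ultimately show "(1, - ((3 - r\<^sup>2) / (1 - r)), (3 - r\<^sup>2) / (1 - r) - 2) \<in> ext (normal_ball r)"
    by (simp only: c_def[symmetric])
qed

section \<open>Every extreme point belongs to a family\<close>

lemma interior_contact_stationary:
  assumes bound: "\<And>x. \<alpha> \<le> x \<Longrightarrow> x \<le> \<beta> \<Longrightarrow> - 1 \<le> quad a b c x \<and> quad a b c x \<le> 1"
    and z: "\<alpha> < z" "z < \<beta>" "\<bar>quad a b c z\<bar> = 1"
  shows "quad' b c z = 0"
proof -
  have low: "quad' b c z = 0"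
    if "\<And>x. \<alpha> \<le> x \<Longrightarrow> x \<le> \<beta> \<Longrightarrow> - 1 \<le> quad a b c x" "quad a b c z = - 1" for a b c
  proof -
    have nn: "0 \<le> quad (1 + a) b c x" if "\<alpha> \<le> x" "x \<le> \<beta>" for x
      using \<open>\<And>x. \<alpha> \<le> x \<Longrightarrow> x \<le> \<beta> \<Longrightarrow> - 1 \<le> quad a b c x\<close>[OF that] by (simp add: quad_def)
    have 0: "quad (1 + a) b c z = 0" using that(2) by (simp add: quad_def)
    have "0 \<le> quad' b c z"
      by (rule quad_nonneg_right_zero[OF _ 0 \<open>z < \<beta>\<close>], rule nn) (use z in linarith)+
    moreover have "quad' b c z \<le> 0"
      by (rule quad_nonneg_left_zero[OF _ 0 \<open>\<alpha> < z\<close>], rule nn) (use z in linarith)+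
    ultimately show ?thesis by simp
  qed
  have neg: "quad (- a) (- b) (- c) x = - quad a b c x" "quad' (- b) (- c) x = - quad' b c x" for x
    by (simp_all add: quad_def quad'_def)
  have "quad a b c z = - 1 \<or> quad (- a) (- b) (- c) z = - 1" using z(3) unfolding neg by linarith
  then show ?thesis
  proof
    assume "quad a b c z = - 1"
    then show ?thesis using low bound by blast
  next
    assume "quad (- a) (- b) (- c) z = - 1"
    then have "quad' (- b) (- c) z = 0" using low[of "- a" "- b" "- c"] bound unfolding neg by simp
    then show ?thesis by (simp add: neg)
  qed
qed

text \<open>Here \<open>f y = c (y - z)\<^sup>2 - 1\<close> with \<open>c > 0\<close>. Taking \<open>(y - z)\<^sup>2\<close> as the direction yields a further
  contact. On the left of \<open>z\<close> it forces \<open>f 0 = 1\<close>, as \<open>f\<close> is decreasing there. The other cases are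
  compared with \<open>g r \<le> 1\<close>, that is, \<open>c (1 - r z)\<^sup>2 \<le> 1 + r\<^sup>2\<close>. On the right of \<open>z\<close> the contact says
  \<open>c (y - z)\<^sup>2 = 2\<close>, which is too large. On the top edge it says \<open>c (1 - u z)\<^sup>2 = 1 + u\<^sup>2\<close>, where the left
  side decreases in \<open>u\<close> and the right side increases, so that \<open>u = r\<close>.\<close>
lemma extreme_tangent_to_bottom:
  assumes ext: "(a, b, c) \<in> ext (normal_ball r)" and r: "0 < r" "r < 1"
    and nf: "(b, c) \<noteq> (0, 0) \<or> \<bar>a\<bar> \<noteq> 1" and ng: "(b, a) \<noteq> (0, 0) \<or> \<bar>c\<bar> \<noteq> 1"
    and z: "0 \<le> z" "z \<le> 1" "quad a b c z = - 1" "quad' b c z = 0"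
  shows "(a, b, c) \<in> valley r"
proof -
  have b: "b = - 2 * c * z" and a: "a = c * z\<^sup>2 - 1"
    using z(3,4) unfolding quad_def quad'_def by algebra+
  have f: "quad a b c y = c * (y - z)\<^sup>2 - 1" for y unfolding quad_def a b by algebra
  have g: "quad c b a u = c * (1 - u * z)\<^sup>2 - u\<^sup>2" for u unfolding quad_def a b by algebra
  have ball: "(a, b, c) \<in> normal_ball r" using ext unfolding ext_normal_ball_iff by blast
  note bounds = normal_ballD[OF ball, unfolded f g]
  have "c \<noteq> 0" using nf a b by auto
  moreover have "0 \<le> c"
  proof -
    define y :: real where "y = (if z = 0 then 1 else 0)"
    have "y \<noteq> z" "0 \<le> y" "y \<le> 1" by (simp_all add: y_def)
    then have "0 \<le> c * (y - z)\<^sup>2" "0 < (y - z)\<^sup>2" using bounds(1)[of y] by simp_all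
    then show ?thesis by (simp add: zero_le_mult_iff)
  qed
  ultimately have "c > 0" by simp
  have z2: "c * z\<^sup>2 \<le> 2" using bounds(2)[of 0] by simp
  have zr: "c * (1 - r * z)\<^sup>2 \<le> 1 + r\<^sup>2" using bounds(4)[of r] r by simp
  have rz: "u * z \<le> u" if "0 \<le> u" for u using that z(2) by (simp add: mult_left_le)
  have "r\<^sup>2 < 1" using r by (simp add: power_less_one_iff)
  have eq: "c * z\<^sup>2 = 2 \<or> c * (1 - r * z)\<^sup>2 = 1 + r\<^sup>2"
  proof (rule extreme_contact[OF ext r(2) nf ng, of "z\<^sup>2" "- 2 * z" 1])
    show "(z\<^sup>2, - 2 * z, 1::real) \<noteq> (0, 0, 0)" by simp
  next
    fix y assume y: "0 \<le> y" "y \<le> 1" "\<bar>quad a b c y\<bar> = 1"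
      "quad (z\<^sup>2) (- 2 * z) 1 y \<noteq> 0 \<or> quad' b c y = 0 \<and> quad' (- 2 * z) 1 y \<noteq> 0"
    have "y \<noteq> z" using y(4) by (auto simp: quad_def quad'_def power2_eq_square)
    then have "0 < c * (y - z)\<^sup>2" using \<open>c > 0\<close> by simp
    then have 2: "c * (y - z)\<^sup>2 = 2" using y(3) unfolding f by (auto simp: abs_if split: if_splits)
    show ?thesis
    proof (cases "y < z")
      case True
      then have "(y - z)\<^sup>2 \<le> z\<^sup>2" using y by (intro abs_le_square_iff[THEN iffD1]) auto
      then have "c * (y - z)\<^sup>2 \<le> c * z\<^sup>2" using \<open>c > 0\<close> by simp
      with 2 z2 show ?thesis by simp
    next
      case False
      then have "(y - z)\<^sup>2 \<le> (1 - r * z)\<^sup>2"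
        using y rz[of r] z r mult_right_mono[of r 1 z] by (intro power_mono) auto
      then have "c * (y - z)\<^sup>2 \<le> c * (1 - r * z)\<^sup>2" using \<open>c > 0\<close> by simp
      with 2 zr \<open>r\<^sup>2 < 1\<close> show ?thesis by simp
    qed
  next
    fix u assume u: "r \<le> u" "u \<le> 1" "\<bar>quad c b a u\<bar> = 1"
      "quad 1 (- 2 * z) (z\<^sup>2) u \<noteq> 0 \<or> quad' b a u = 0 \<and> quad' (- 2 * z) (z\<^sup>2) u \<noteq> 0"
    have "quad 1 (- 2 * z) (z\<^sup>2) u = (1 - u * z)\<^sup>2" "quad' (- 2 * z) (z\<^sup>2) u = - 2 * z * (1 - u * z)"
      unfolding quad_def quad'_def by algebra+
    then have "1 - u * z \<noteq> 0" using u(4) by auto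
    then have "0 < c * (1 - u * z)\<^sup>2" using \<open>c > 0\<close> by simp
    moreover have "u\<^sup>2 \<le> 1" "r\<^sup>2 \<le> u\<^sup>2" using u r by (auto simp: power_le_one intro: power_mono)
    ultimately have 1: "c * (1 - u * z)\<^sup>2 = 1 + u\<^sup>2"
      using u(3) unfolding g by (auto simp: abs_if split: if_splits)
    have "u * z \<le> 1" using u r z by (intro mult_le_one) auto
    then have "(1 - u * z)\<^sup>2 \<le> (1 - r * z)\<^sup>2"
      using u z mult_right_mono[of r u z] by (intro power_mono) auto
    then have "c * (1 - u * z)\<^sup>2 \<le> c * (1 - r * z)\<^sup>2" using \<open>c > 0\<close> by simp
    with 1 zr \<open>r\<^sup>2 \<le> u\<^sup>2\<close> show ?thesis by simp
  qed
  \<comment> \<open>The parameters of the family: \<open>c (y - z)\<^sup>2 = (w y - s)\<^sup>2\<close>.\<close>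
  define w where "w = sqrt c"
  define s where "s = w * z"
  have w: "w > 0" "c = w\<^sup>2" using \<open>c > 0\<close> by (simp_all add: w_def)
  have s: "0 \<le> s" "s \<le> w" using w z by (simp_all add: s_def mult_left_le)
  have s2: "s\<^sup>2 = c * z\<^sup>2" by (simp add: s_def w(2) power_mult_distrib)
  have wr: "w - r * s = w * (1 - r * z)" by (simp add: s_def algebra_simps)
  have "0 \<le> 1 - r * z" using rz[of r] r by linarith
  then have wr0: "0 \<le> w - r * s" unfolding wr using w by simp
  have wr2: "(w - r * s)\<^sup>2 = c * (1 - r * z)\<^sup>2" unfolding wr w(2) by algebra
  have "s \<le> sqrt 2" using z2 s2 by (simp add: real_le_rsqrt)
  moreover have "w - r * s \<le> sqrt (1 + r\<^sup>2)" using zr wr2 by (simp add: real_le_rsqrt)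
  moreover have "s = sqrt 2 \<or> w - r * s = sqrt (1 + r\<^sup>2)"
    using eq
  proof
    assume "c * z\<^sup>2 = 2"
    then show ?thesis using real_sqrt_unique[of s 2] s s2 by simp
  next
    assume "c * (1 - r * z)\<^sup>2 = 1 + r\<^sup>2"
    then show ?thesis using real_sqrt_unique[OF _ wr0] wr2 by simp
  qed
  moreover have "(a, b, c) = (s\<^sup>2 - 1, - (2 * s * w), w\<^sup>2)"
    unfolding a b s_def w(2) by (simp add: power2_eq_square algebra_simps)
  ultimately show ?thesis unfolding valley_def using s by blast
qed

text \<open>Here \<open>g u = 1 + a (u - z)\<^sup>2\<close> with \<open>-1 \<le> a < 0\<close>, and only \<open>a = -1\<close> is to be shown. If \<open>a > -1\<close>, both
  \<open>g u\<close> and \<open>f y = y\<^sup>2 + a (1 - z y)\<^sup>2\<close> stay strictly between \<open>-1\<close> and \<open>1\<close> away from the point of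
  tangency, so the direction \<open>(u - z)\<^sup>2\<close> contradicts extremality.\<close>
lemma extreme_tangent_on_top_edge:
  assumes ext: "(a, b, c) \<in> ext (normal_ball r)" and r: "0 < r" "r < 1"
    and nf: "(b, c) \<noteq> (0, 0) \<or> \<bar>a\<bar> \<noteq> 1" and ng: "(b, a) \<noteq> (0, 0) \<or> \<bar>c\<bar> \<noteq> 1"
    and z: "r \<le> z" "z \<le> 1" "quad c b a z = 1" "quad' b a z = 0"
  shows "(a, b, c) \<in> ridge r"
proof -
  have b: "b = - 2 * a * z" and c: "c = 1 + a * z\<^sup>2"
    using z(3,4) unfolding quad_def quad'_def by algebra+
  have f: "quad a b c y = y\<^sup>2 + a * (1 - z * y)\<^sup>2" for y unfolding quad_def b c by algebra
  have g: "quad c b a u = 1 + a * (u - z)\<^sup>2" for u unfolding quad_def b c by algebra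
  have ball: "(a, b, c) \<in> normal_ball r" using ext unfolding ext_normal_ball_iff by blast
  note bounds = normal_ballD[OF ball, unfolded f g]
  have "a \<noteq> 0" using ng b c by auto
  moreover have "a \<le> 0"
  proof -
    define u where "u = (if z = 1 then r else 1)"
    have "u \<noteq> z" "r \<le> u" "u \<le> 1" using r by (simp_all add: u_def)
    then have "a * (u - z)\<^sup>2 \<le> 0" "0 < (u - z)\<^sup>2" using bounds(4)[of u] by simp_all
    then show ?thesis by (simp add: mult_le_0_iff)
  qed
  ultimately have "a < 0" by simp
  have "- 1 \<le> a" using bounds(1)[of 0] by simp
  have "a = - 1"
  proof (rule ccontr)
    assume "a \<noteq> - 1"
    with \<open>- 1 \<le> a\<close> have "- 1 < a" by simp
    have small: "- 1 < a * t" if "0 \<le> t" "t \<le> 1" for t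
    proof -
      have "a * 1 \<le> a * t" using that \<open>a < 0\<close> by (intro mult_left_mono_neg) auto
      with \<open>- 1 < a\<close> show ?thesis by simp
    qed
    show False
    proof (rule extreme_contact[OF ext r(2) nf ng, of 1 "- 2 * z" "z\<^sup>2"])
      show "(1::real, - 2 * z, z\<^sup>2) \<noteq> (0, 0, 0)" by simp
    next
      fix y assume y: "0 \<le> y" "y \<le> 1" "\<bar>quad a b c y\<bar> = 1"
        "quad 1 (- 2 * z) (z\<^sup>2) y \<noteq> 0 \<or> quad' b c y = 0 \<and> quad' (- 2 * z) (z\<^sup>2) y \<noteq> 0"
      have "quad 1 (- 2 * z) (z\<^sup>2) y = (1 - z * y)\<^sup>2" "quad' (- 2 * z) (z\<^sup>2) y = - 2 * z * (1 - z * y)"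
        unfolding quad_def quad'_def by algebra+
      then have "1 - z * y \<noteq> 0" using y(4) by auto
      then have "a * (1 - z * y)\<^sup>2 < 0" using \<open>a < 0\<close> by (simp add: mult_neg_pos)
      moreover have "0 \<le> z * y" "z * y \<le> 1" using y z r by (auto intro: mult_le_one)
      then have "- 1 < a * (1 - z * y)\<^sup>2" by (intro small) (auto simp: power_le_one)
      moreover have "0 \<le> y\<^sup>2" "y\<^sup>2 \<le> 1" using y by (auto simp: power_le_one)
      ultimately show False using y(3) unfolding f by linarith
    next
      fix u assume u: "r \<le> u" "u \<le> 1" "\<bar>quad c b a u\<bar> = 1"
        "quad (z\<^sup>2) (- 2 * z) 1 u \<noteq> 0 \<or> quad' b a u = 0 \<and> quad' (- 2 * z) 1 u \<noteq> 0"
      have "u \<noteq> z" using u(4) by (auto simp: quad_def quad'_def power2_eq_square)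
      then have "a * (u - z)\<^sup>2 < 0" using \<open>a < 0\<close> by (simp add: mult_neg_pos)
      moreover have "(u - z)\<^sup>2 \<le> 1" using u z r by (simp add: abs_square_le_1 abs_le_iff)
      then have "- 1 < a * (u - z)\<^sup>2" by (intro small) auto
      ultimately show False using u(3) unfolding g by linarith
    qed
  qed
  with b c z show ?thesis unfolding ridge_def by auto
qed

text \<open>All contacts are end points, so they lie among \<open>y = 0\<close>, \<open>y = 1\<close> (the same point as \<open>u = 1\<close>) and
  \<open>u = r\<close>. To see that one of them is a contact, take as direction the quadratic vanishing at the
  other two.\<close>
lemma extreme_without_tangency:
  assumes ext: "(a, b, c) \<in> ext (normal_ball r)" and r: "0 < r" "r < 1"
    and nf: "(b, c) \<noteq> (0, 0) \<or> \<bar>a\<bar> \<noteq> 1" and ng: "(b, a) \<noteq> (0, 0) \<or> \<bar>c\<bar> \<noteq> 1"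
    and tf: "\<And>y. 0 \<le> y \<Longrightarrow> y \<le> 1 \<Longrightarrow> \<bar>quad a b c y\<bar> = 1 \<Longrightarrow> quad' b c y \<noteq> 0"
    and tg: "\<And>u. r \<le> u \<Longrightarrow> u \<le> 1 \<Longrightarrow> \<bar>quad c b a u\<bar> = 1 \<Longrightarrow> quad' b a u \<noteq> 0"
  shows "\<bar>quad a b c 0\<bar> = 1" "\<bar>quad a b c 1\<bar> = 1" "\<bar>quad c b a r\<bar> = 1"
proof -
  have ball: "(a, b, c) \<in> normal_ball r" using ext unfolding ext_normal_ball_iff by blast
  note bounds = normal_ballD[OF ball]
  have cf: "y = 0 \<or> y = 1" if y: "0 \<le> y" "y \<le> 1" "\<bar>quad a b c y\<bar> = 1" for y
  proof (rule ccontr)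
    assume "\<not> ?thesis"
    then have "quad' b c y = 0"
      using y bounds by (intro interior_contact_stationary[of 0 1 a b c]) auto
    with tf y show False by blast
  qed
  have cg: "u = r \<or> u = 1" if u: "r \<le> u" "u \<le> 1" "\<bar>quad c b a u\<bar> = 1" for u
  proof (rule ccontr)
    assume "\<not> ?thesis"
    then have "quad' b a u = 0"
      using u bounds by (intro interior_contact_stationary[of r 1 c b a]) auto
    with tg u show False by blast
  qed
  have contact: thesis
    if d: "(a', b', c') \<noteq> (0, 0, 0)"
      and f: "\<And>y. y = 0 \<or> y = 1 \<Longrightarrow> \<bar>quad a b c y\<bar> = 1 \<Longrightarrow> quad a' b' c' y \<noteq> 0 \<Longrightarrow> thesis"
      and g: "\<And>u. u = r \<or> u = 1 \<Longrightarrow> \<bar>quad c b a u\<bar> = 1 \<Longrightarrow> quad c' b' a' u \<noteq> 0 \<Longrightarrow> thesis"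
    for a' b' c' thesis
  proof (rule extreme_contact[OF ext r(2) nf ng d])
    fix y assume "0 \<le> y" "y \<le> 1" "\<bar>quad a b c y\<bar> = 1"
      "quad a' b' c' y \<noteq> 0 \<or> quad' b c y = 0 \<and> quad' b' c' y \<noteq> 0"
    then show thesis using f[of y] cf[of y] tf[of y] by blast
  next
    fix u assume "r \<le> u" "u \<le> 1" "\<bar>quad c b a u\<bar> = 1"
      "quad c' b' a' u \<noteq> 0 \<or> quad' b a u = 0 \<and> quad' b' a' u \<noteq> 0"
    then show thesis using g[of u] cg[of u] tg[of u] by blast
  qed
  \<comment> \<open>On the right edge the directions are \<open>(y - 1) (1 - r y)\<close>, \<open>y (1 - r y)\<close> and \<open>y (y - 1)\<close>.\<close>
  show "\<bar>quad a b c 0\<bar> = 1"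
    by (rule contact[of "- 1" "1 + r" "- r"]) (auto simp: quad_def algebra_simps power2_eq_square)
  show "\<bar>quad a b c 1\<bar> = 1"
    by (rule contact[of 0 1 "- r"]) (auto simp: quad_def algebra_simps power2_eq_square)
  show "\<bar>quad c b a r\<bar> = 1"
    by (rule contact[of 0 "- 1" 1]) (auto simp: quad_def algebra_simps power2_eq_square)
qed

text \<open>Three values determine the quadratic, so there is one candidate for each sign pattern of
  \<open>(f 1, g r)\<close>. The pattern \<open>(1, -1)\<close> makes \<open>f\<close> exceed \<open>1\<close> between its end points, and \<open>(-1, -1)\<close>
  makes the convex \<open>g\<close> fall below \<open>-1\<close> there. For \<open>(-1, 1)\<close> the slope of \<open>f\<close> at \<open>1\<close> has to be negative,
  which is the inequality for \<open>r\<close>.\<close>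
lemma three_corner_contacts:
  assumes ball: "(1, b, c) \<in> normal_ball r" and r: "0 < r" "r < 1"
    and f1: "\<bar>quad 1 b c 1\<bar> = 1" and gr: "\<bar>quad c b 1 r\<bar> = 1" and tf: "quad' b c 1 \<noteq> 0"
  shows "b = - (1 + r) \<and> c = 1 + r \<or>
    r\<^sup>2 - 4 * r + 1 > 0 \<and> b = - ((3 - r\<^sup>2) / (1 - r)) \<and> c = (3 - r\<^sup>2) / (1 - r) - 2"
proof -
  note bounds = normal_ballD[OF ball]
  consider "1 + b + c = 1" "c + b * r + r\<^sup>2 = 1" | "1 + b + c = 1" "c + b * r + r\<^sup>2 = - 1"
    | "1 + b + c = - 1" "c + b * r + r\<^sup>2 = 1" | "1 + b + c = - 1" "c + b * r + r\<^sup>2 = - 1"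
    using f1 gr by (fastforce simp: quad_def abs_if split: if_splits)
  then show ?thesis
  proof cases
    case 1
    then have "(b + 1 + r) * (1 - r) = 0" by algebra
    with 1 r show ?thesis by auto
  next
    case 2
    then have "b * (1 - r) = 1 + r\<^sup>2" by algebra
    then have "0 < b * (1 - r)" by (simp add: add_pos_nonneg)
    then have "0 < b" using r by (simp add: zero_less_mult_iff)
    have "quad 1 b c (1 / 2) \<le> 1" by (rule bounds) auto
    moreover have "c = - b" using 2 by simp
    ultimately show ?thesis using \<open>0 < b\<close> by (simp add: quad_def power2_eq_square)
  next
    case 3
    then have br: "b * (1 - r) = - (3 - r\<^sup>2)" by algebra
    then have b: "b = - ((3 - r\<^sup>2) / (1 - r))" using r by (simp add: field_simps)
    have nn: "0 \<le> quad 2 b c x" if "0 \<le> x" "x \<le> 1" for x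
      using bounds(1)[OF that] by (simp add: quad_def)
    have "quad' b c 1 \<le> 0"
      by (rule quad_nonneg_left_zero[of 0 1 2]) (use nn 3 in \<open>auto simp: quad_def\<close>)
    with tf 3 have "- 4 < b" by (simp add: quad'_def)
    then have "- 4 * (1 - r) < b * (1 - r)" using r by (intro mult_strict_right_mono) auto
    with br have "r\<^sup>2 - 4 * r + 1 > 0" by simp
    with b 3 show ?thesis by simp
  next
    case 4
    have "quad c b 1 ((1 + r) / 2) = - 1 - (1 - r)\<^sup>2 / 4"
    proof -
      have "c = - 2 - b" "b * r = 1 + b - r\<^sup>2" using 4 by simp_all
      then show ?thesis by (simp add: quad_def power2_eq_square field_simps)
    qed
    moreover have "- 1 \<le> quad c b 1 ((1 + r) / 2)" using r by (intro bounds) auto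
    ultimately have "(1 - r)\<^sup>2 \<le> 0" by simp
    with r show ?thesis by simp
  qed
qed

definition normal_extreme :: "real \<Rightarrow> (real \<times> real \<times> real) set" where
  "normal_extreme r = valley r \<union> ridge r \<union> {(0, 0, 1), (1, 0, 0), (1, - (1 + r), 1 + r)} \<union>
     (if r\<^sup>2 - 4 * r + 1 > 0 then {(1, - ((3 - r\<^sup>2) / (1 - r)), (3 - r\<^sup>2) / (1 - r) - 2)} else {})"

lemma mem_plus_minus: "p \<in> plus_minus S \<longleftrightarrow> p \<in> S \<or> - p \<in> S" for p :: "'a::group_add"
  unfolding plus_minus_def by (force simp: image_iff)

text \<open>Replacing an extreme point by its negative, the value at a tangential contact may be taken to be
  \<open>-1\<close> on the right edge and \<open>1\<close> on the top edge; without tangency, \<open>f 0\<close> may be taken to be \<open>1\<close>.\<close>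
theorem ext_normal_ball:
  assumes r: "0 < r" "r < 1"
  shows "ext (normal_ball r) = plus_minus (normal_extreme r)"
proof (intro equalityI subsetI)
  fix p assume "p \<in> plus_minus (normal_extreme r)"
  moreover have "q \<in> ext (normal_ball r)" if "q \<in> normal_extreme r" for q
  proof -
    have "q \<in> valley r \<or> q \<in> ridge r \<or> q = (0, 0, 1) \<or> q = (1, 0, 0) \<or> q = (1, - (1 + r), 1 + r) \<or>
        r\<^sup>2 - 4 * r + 1 > 0 \<and> q = (1, - ((3 - r\<^sup>2) / (1 - r)), (3 - r\<^sup>2) / (1 - r) - 2)"
      using that unfolding normal_extreme_def by (auto split: if_splits)
    then show ?thesis
      using valley_extreme[OF r] ridge_extreme[OF r] square_monomials_extreme[OF r]
        corner_points_extreme[OF r] by blast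
  qed
  ultimately show "p \<in> ext (normal_ball r)"
    unfolding mem_plus_minus using uminus_ext_normal_ball[of p r] by blast
next
  fix p assume ext: "p \<in> ext (normal_ball r)"
  obtain a b c where p: "p = (a, b, c)" by (cases p)
  note ext = ext[unfolded p]
  have ext': "(- a, - b, - c) \<in> ext (normal_ball r)"
    using ext uminus_ext_normal_ball[of "(a, b, c)" r] by simp
  have neg: "quad (- a) (- b) (- c) x = - quad a b c x" "quad' (- b) (- c) x = - quad' b c x"
    for a b c x by (simp_all add: quad_def quad'_def)
  show "p \<in> plus_minus (normal_extreme r)"
  proof (cases "(b = 0 \<and> c = 0 \<and> \<bar>a\<bar> = 1) \<or> (b = 0 \<and> a = 0 \<and> \<bar>c\<bar> = 1)")
    case True
    then show ?thesis unfolding mem_plus_minus p normal_extreme_def by (auto simp: abs_if split: if_splits)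
  next
    case False
    then have nf: "(b, c) \<noteq> (0, 0) \<or> \<bar>a\<bar> \<noteq> 1" and ng: "(b, a) \<noteq> (0, 0) \<or> \<bar>c\<bar> \<noteq> 1"
      and nf': "(- b, - c) \<noteq> (0, 0) \<or> \<bar>- a\<bar> \<noteq> 1" and ng': "(- b, - a) \<noteq> (0, 0) \<or> \<bar>- c\<bar> \<noteq> 1"
      by auto
    consider (f) y where "0 \<le> y" "y \<le> 1" "\<bar>quad a b c y\<bar> = 1" "quad' b c y = 0"
      | (g) u where "r \<le> u" "u \<le> 1" "\<bar>quad c b a u\<bar> = 1" "quad' b a u = 0"
      | (none) "\<And>y. 0 \<le> y \<Longrightarrow> y \<le> 1 \<Longrightarrow> \<bar>quad a b c y\<bar> = 1 \<Longrightarrow> quad' b c y \<noteq> 0"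
        "\<And>u. r \<le> u \<Longrightarrow> u \<le> 1 \<Longrightarrow> \<bar>quad c b a u\<bar> = 1 \<Longrightarrow> quad' b a u \<noteq> 0"
      by blast
    then show ?thesis
    proof cases
      case f
      have "p \<in> valley r \<or> - p \<in> valley r"
      proof (cases "quad a b c y = - 1")
        case True
        then show ?thesis using extreme_tangent_to_bottom[OF ext r nf ng] f p by simp
      next
        case False
        then have "quad (- a) (- b) (- c) y = - 1" using f(3) unfolding neg by linarith
        then show ?thesis using extreme_tangent_to_bottom[OF ext' r nf' ng'] f p by (simp add: neg)
      qed
      then show ?thesis unfolding mem_plus_minus normal_extreme_def by blast
    next
      case g
      have "p \<in> ridge r \<or> - p \<in> ridge r"
      proof (cases "quad c b a u = 1")
        case True
        then show ?thesis using extreme_tangent_on_top_edge[OF ext r nf ng] g p by simp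
      next
        case False
        then have "quad (- c) (- b) (- a) u = 1" using g(3) unfolding neg by linarith
        then show ?thesis using extreme_tangent_on_top_edge[OF ext' r nf' ng'] g p by (simp add: neg)
      qed
      then show ?thesis unfolding mem_plus_minus normal_extreme_def by blast
    next
      case none
      note contacts = extreme_without_tangency[OF ext r nf ng none]
      have "\<bar>a\<bar> = 1" using contacts(1) by (simp add: quad_def)
      then consider "a = 1" | "- a = 1" by linarith
      then show ?thesis
      proof cases
        case 1
        have "(1, b, c) \<in> normal_ball r" using ext 1 unfolding ext_normal_ball_iff by blast
        then have "(1, b, c) \<in> normal_extreme r"
          using three_corner_contacts[of b c r, OF _ r] contacts none(1)[of 1] 1
          unfolding normal_extreme_def by auto
        then show ?thesis unfolding mem_plus_minus p 1 by blast
      next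
        case 2
        have "(- a, - b, - c) \<in> normal_ball r" using ext' unfolding ext_normal_ball_iff by blast
        then have "(1, - b, - c) \<in> normal_ball r" by (simp only: 2)
        moreover have "\<bar>quad 1 (- b) (- c) 1\<bar> = 1" "\<bar>quad (- c) (- b) 1 r\<bar> = 1"
          using contacts(2,3) by (simp_all only: neg(1)[of a b c 1, unfolded 2]
              neg(1)[of c b a r, unfolded 2] abs_minus_cancel)
        moreover have "quad' (- b) (- c) 1 \<noteq> 0"
          using none(1)[OF zero_le_one order_refl contacts(2)] by (simp only: neg(2) neg_equal_0_iff_equal not_False_eq_True)
        ultimately have "(1, - b, - c) \<in> normal_extreme r"
          using three_corner_contacts[OF _ r] unfolding normal_extreme_def by fastforce
        then show ?thesis unfolding mem_plus_minus p using 2 by simp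
      qed
    qed
  qed
qed

section \<open>Passage between the square and the normalised ball\<close>

lemma sup_norm_le_iff: "sup_norm h p \<le> 1 \<longleftrightarrow> (\<forall>z\<in>square h. \<bar>quad_form p z\<bar> \<le> 1)"
proof -
  obtain a b c where p: "p = (a, b, c)" by (cases p)
  have "compact (square h)" unfolding square_def by (intro compact_Times compact_Icc)
  moreover have "continuous_on (square h) (\<lambda>z. \<bar>quad_form p z\<bar>)"
  proof -
    have "(\<lambda>z. \<bar>quad_form p z\<bar>) = (\<lambda>z. \<bar>a * (fst z)\<^sup>2 + b * fst z * snd z + c * (snd z)\<^sup>2\<bar>)"
      unfolding p by (rule ext) (metis prod.collapse quad_form.simps)
    then show ?thesis by (simp only:) (intro continuous_intros)
  qed
  ultimately have "compact ((\<lambda>z. \<bar>quad_form p z\<bar>) ` square h)" by (rule compact_continuous_image[rotated])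
  then have "bdd_above ((\<lambda>z. \<bar>quad_form p z\<bar>) ` square h)"
    by (intro bounded_imp_bdd_above compact_imp_bounded)
  moreover have "square h \<noteq> {}" by (simp add: square_def)
  ultimately show ?thesis unfolding sup_norm_def by (simp add: cSUP_le_iff)
qed

text \<open>A point of the square is moved along its ray to the boundary: to the right edge if
  \<open>k y \<le> x\<close>, and to the top edge otherwise. The form only grows in modulus on the way.\<close>
lemma unit_ball_iff_normal_ball:
  assumes h: "h > 0" and k: "k = h + 1"
  shows "(a, b, c) \<in> unit_ball h \<longleftrightarrow> (k\<^sup>2 * a, k * b, c) \<in> normal_ball (h / k)"
proof -
  have "k > 0" using h k by simp
  have right: "quad_form (a, b, c) (x, y) = (x / k)\<^sup>2 * quad (k\<^sup>2 * a) (k * b) c (k * y / x)"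
    if "x \<noteq> 0" for x y
    using that \<open>k > 0\<close> by (simp add: quad_def field_simps power2_eq_square)
  have top: "quad_form (a, b, c) (x, y) = y\<^sup>2 * quad c (k * b) (k\<^sup>2 * a) (x / (k * y))"
    if "y \<noteq> 0" for x y
    using that \<open>k > 0\<close> by (simp add: quad_def field_simps power2_eq_square)
  have scale: "\<bar>v * q\<bar> \<le> 1" if "0 \<le> v" "v \<le> 1" "\<bar>q\<bar> \<le> 1" for v q :: real
    using that by (simp add: abs_mult mult_le_one)
  show ?thesis
  proof
    assume "(a, b, c) \<in> unit_ball h"
    then have B: "\<bar>quad_form (a, b, c) (x, y)\<bar> \<le> 1" if "h \<le> x" "x \<le> k" "0 \<le> y" "y \<le> 1" for x y
      using that k by (auto simp: unit_ball_def sup_norm_le_iff square_def)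
    have "\<bar>quad (k\<^sup>2 * a) (k * b) c y\<bar> \<le> 1" if "0 \<le> y" "y \<le> 1" for y
      using B[of k y] right[of k y] that k \<open>k > 0\<close> by simp
    moreover have "\<bar>quad c (k * b) (k\<^sup>2 * a) u\<bar> \<le> 1" if "h / k \<le> u" "u \<le> 1" for u
      using B[of "k * u" 1] top[of 1 "k * u"] that \<open>k > 0\<close> by (simp add: field_simps)
    ultimately show "(k\<^sup>2 * a, k * b, c) \<in> normal_ball (h / k)" by (simp add: normal_ball_def)
  next
    assume N: "(k\<^sup>2 * a, k * b, c) \<in> normal_ball (h / k)"
    have "\<bar>quad_form (a, b, c) (x, y)\<bar> \<le> 1" if xy: "h \<le> x" "x \<le> k" "0 \<le> y" "y \<le> 1" for x y
    proof (cases "k * y \<le> x")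
      case True
      have "\<bar>quad (k\<^sup>2 * a) (k * b) c (k * y / x)\<bar> \<le> 1"
        using N True xy h \<open>k > 0\<close> by (auto simp: normal_ball_def)
      moreover have "(x / k)\<^sup>2 \<le> 1" using xy h \<open>k > 0\<close> by (simp add: power_le_one)
      ultimately show ?thesis using right[of x y] xy h by (simp add: scale)
    next
      case False
      then have "y > 0" using xy h \<open>k > 0\<close> by (smt (verit) mult_nonneg_nonpos)
      have "h * y \<le> x * 1" using xy h by (intro mult_mono) auto
      then have "h / k \<le> x / (k * y)" using \<open>y > 0\<close> \<open>k > 0\<close> by (simp add: field_simps)
      moreover have "x / (k * y) \<le> 1" using False \<open>y > 0\<close> \<open>k > 0\<close> by simp
      ultimately have "\<bar>quad c (k * b) (k\<^sup>2 * a) (x / (k * y))\<bar> \<le> 1"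
        using N by (auto simp: normal_ball_def)
      moreover have "y\<^sup>2 \<le> 1" using xy by (simp add: power_le_one)
      ultimately show ?thesis using top[of y x] \<open>y > 0\<close> by (simp add: scale)
    qed
    then show "(a, b, c) \<in> unit_ball h"
      using k by (auto simp: unit_ball_def sup_norm_le_iff square_def)
  qed
qed

lemma ext_unit_ball_iff:
  assumes h: "h > 0" and k: "k = h + 1"
  shows "(a, b, c) \<in> ext (unit_ball h) \<longleftrightarrow> (k\<^sup>2 * a, k * b, c) \<in> ext (normal_ball (h / k))"
proof -
  define M where "M = (\<lambda>(a, b, c). (k\<^sup>2 * a, k * b, c :: real))"
  have "k \<noteq> 0" using h k by simp
  have lin: "linear M"
    by (rule linearI) (auto simp: M_def algebra_simps)
  have inj: "inj M" using \<open>k \<noteq> 0\<close> by (auto simp: inj_def M_def)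
  have mem: "M p \<in> normal_ball (h / k) \<longleftrightarrow> p \<in> unit_ball h" for p
    using unit_ball_iff_normal_ball[OF h k] by (cases p) (simp add: M_def)
  have surj: "\<exists>p. q = M p" for q
  proof -
    obtain a b c where "q = (a, b, c)" by (cases q)
    then have "q = M (a / k\<^sup>2, b / k, c)" using \<open>k \<noteq> 0\<close> by (simp add: M_def)
    then show ?thesis ..
  qed
  have "M ` unit_ball h = normal_ball (h / k)"
  proof (intro equalityI subsetI)
    fix q assume "q \<in> M ` unit_ball h"
    then show "q \<in> normal_ball (h / k)" unfolding image_iff using mem by blast
  next
    fix q assume "q \<in> normal_ball (h / k)"
    then show "q \<in> M ` unit_ball h" using surj[of q] mem by blast
  qed
  then show ?thesis
    using face_of_linear_image[OF lin inj, of "{(a, b, c)}" "unit_ball h"]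
    by (simp add: face_of_singleton ext_def M_def)
qed

text \<open>The two arcs of the family, according to which of the two bounds is attained: \<open>g r = 1\<close>, solved
  for \<open>w\<close>, or \<open>f 0 = 1\<close>, which is \<open>s = sqrt 2\<close>. In the first arc \<open>s \<le> sqrt (1 + r\<^sup>2) + r s\<close> keeps the
  vertex on the right edge.\<close>
lemma valley_iff:
  "p \<in> valley r \<longleftrightarrow>
    (\<exists>s. 0 \<le> s \<and> s \<le> sqrt 2 \<and> s \<le> sqrt (1 + r\<^sup>2) + r * s \<and>
       p = (s\<^sup>2 - 1, - (2 * s * (sqrt (1 + r\<^sup>2) + r * s)), (sqrt (1 + r\<^sup>2) + r * s)\<^sup>2)) \<or>
    (\<exists>w. sqrt 2 \<le> w \<and> w \<le> sqrt (1 + r\<^sup>2) + r * sqrt 2 \<and> p = (1, - (2 * sqrt 2 * w), w\<^sup>2))"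
  (is "_ \<longleftrightarrow> ?A \<or> ?B")
proof
  assume "p \<in> valley r"
  then obtain s w where p: "p = (s\<^sup>2 - 1, - (2 * s * w), w\<^sup>2)" and s: "0 \<le> s" "s \<le> w" "s \<le> sqrt 2"
    and w: "w - r * s \<le> sqrt (1 + r\<^sup>2)" and eq: "s = sqrt 2 \<or> w - r * s = sqrt (1 + r\<^sup>2)"
    unfolding valley_def by blast
  from eq show "?A \<or> ?B"
  proof
    assume "s = sqrt 2"
    then have "sqrt 2 \<le> w \<and> w \<le> sqrt (1 + r\<^sup>2) + r * sqrt 2 \<and> p = (1, - (2 * sqrt 2 * w), w\<^sup>2)"
      using p s w by simp
    then show ?thesis by blast
  next
    assume "w - r * s = sqrt (1 + r\<^sup>2)"
    then have "w = sqrt (1 + r\<^sup>2) + r * s" by simp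
    then show ?thesis using p s by blast
  qed
next
  assume "?A \<or> ?B"
  then show "p \<in> valley r"
  proof
    assume ?A
    then obtain s where s: "0 \<le> s" "s \<le> sqrt 2" "s \<le> sqrt (1 + r\<^sup>2) + r * s"
      and p: "p = (s\<^sup>2 - 1, - (2 * s * (sqrt (1 + r\<^sup>2) + r * s)), (sqrt (1 + r\<^sup>2) + r * s)\<^sup>2)" by blast
    show ?thesis unfolding valley_def p mem_Collect_eq
      by (rule exI[of _ s], rule exI[of _ "sqrt (1 + r\<^sup>2) + r * s"]) (use s in simp)
  next
    assume ?B
    then obtain w where w: "sqrt 2 \<le> w" "w \<le> sqrt (1 + r\<^sup>2) + r * sqrt 2"
      and p: "p = (1, - (2 * sqrt 2 * w), w\<^sup>2)" by blast
    show ?thesis unfolding valley_def p mem_Collect_eq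
      by (rule exI[of _ "sqrt 2"], rule exI[of _ w]) (use w in simp)
  qed
qed

context
  fixes h k r :: real
  assumes h: "h > 0" and k: "k = h + 1" and r: "r = h / k"
begin

lemma k_pos: "k > 0" and r_pos: "0 < r" and r_less_1: "r < 1" and kr: "k * r = h"
  using h by (auto simp: k r)

lemma k2_r2: "k\<^sup>2 * (1 + r\<^sup>2) = 2 * h\<^sup>2 + 2 * h + 1"
proof -
  have "k\<^sup>2 * (1 + r\<^sup>2) = k\<^sup>2 + (k * r)\<^sup>2" by algebra
  then show ?thesis unfolding kr by (simp add: k power2_eq_square algebra_simps)
qed

lemma threshold_iff: "(sqrt 3 - 1) / 2 \<le> h \<longleftrightarrow> \<not> r\<^sup>2 - 4 * r + 1 > 0"
proof -
  have "(sqrt 3 - 1) / 2 \<le> h \<longleftrightarrow> sqrt 3 \<le> 2 * h + 1" by auto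
  also have "\<dots> \<longleftrightarrow> 3 \<le> (2 * h + 1)\<^sup>2"
    using h real_le_lsqrt[of 3 "2 * h + 1"] real_sqrt_le_iff[of 3 "(2 * h + 1)\<^sup>2"] by simp
  also have "\<dots> \<longleftrightarrow> - k\<^sup>2 * (r\<^sup>2 - 4 * r + 1) \<ge> 0"
  proof -
    have "- k\<^sup>2 * (r\<^sup>2 - 4 * r + 1) = 4 * k * (k * r) - k\<^sup>2 * (1 + r\<^sup>2)" by algebra
    then have "2 * (- k\<^sup>2 * (r\<^sup>2 - 4 * r + 1)) = (2 * h + 1)\<^sup>2 - 3"
      unfolding kr k2_r2 by (simp add: k power2_eq_square algebra_simps)
    then show ?thesis by linarith
  qed
  also have "\<dots> \<longleftrightarrow> \<not> r\<^sup>2 - 4 * r + 1 > 0"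
    using k_pos by (auto simp: mult_le_0_iff not_less)
  finally show ?thesis .
qed

text \<open>The substitution \<open>s = k sqrt (t + 1 / k\<^sup>2)\<close> turns the curve given by \<open>Gamma_fun\<close> into the arc
  \<open>g r = 1\<close> of \<open>valley\<close>: the square root of \<open>Gamma_fun h t\<close> is the parameter \<open>w\<close> of that arc.\<close>
lemma Gamma_arc:
  assumes t: "- (1 / k\<^sup>2) \<le> t"
  defines "s \<equiv> k * sqrt (t + 1 / k\<^sup>2)"
  defines "w \<equiv> sqrt (1 + r\<^sup>2) + r * s"
  shows "0 \<le> s" "s\<^sup>2 = k\<^sup>2 * t + 1" "Gamma_fun h t = w\<^sup>2"
    "k * ((1 - h\<^sup>2 * t - Gamma_fun h t) / h) = - (2 * s * w)"
proof -
  show "0 \<le> s" using t k_pos by (simp add: s_def)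
  have "s\<^sup>2 = k\<^sup>2 * (t + 1 / k\<^sup>2)" using t by (simp add: s_def power_mult_distrib)
  then show s2: "s\<^sup>2 = k\<^sup>2 * t + 1" using k_pos by (simp add: distrib_left)
  have "h * sqrt (t + 1 / k\<^sup>2) = r * s" using kr by (simp add: s_def mult.assoc[symmetric] mult.commute)
  moreover have "h\<^sup>2 * (1 / k\<^sup>2) = r\<^sup>2" by (simp add: r power_divide)
  ultimately show G: "Gamma_fun h t = w\<^sup>2"
    unfolding Gamma_fun_def bound_a_def w_def k by simp
  have "(sqrt (1 + r\<^sup>2))\<^sup>2 = 1 + r\<^sup>2" by simp
  then have "1 - r\<^sup>2 * (s\<^sup>2 - 1) - w\<^sup>2 = - (2 * r * s * w)" unfolding w_def by algebra
  moreover have "h\<^sup>2 * t = r\<^sup>2 * (s\<^sup>2 - 1)" unfolding s2 kr[symmetric] by algebra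
  ultimately have "1 - h\<^sup>2 * t - Gamma_fun h t = - (2 * r * s * w)" unfolding G by simp
  then show "k * ((1 - h\<^sup>2 * t - Gamma_fun h t) / h) = - (2 * s * w)"
    using h k_pos by (simp add: r)
qed

lemma Gamma_family_iff:
  "(\<exists>t\<in>{- (1 / k\<^sup>2)..T}. (a, b, c) = (t, (1 - h\<^sup>2 * t - Gamma_fun h t) / h, Gamma_fun h t)) \<longleftrightarrow>
    (\<exists>s. 0 \<le> s \<and> s\<^sup>2 \<le> k\<^sup>2 * T + 1 \<and>
      (k\<^sup>2 * a, k * b, c) =
        (s\<^sup>2 - 1, - (2 * s * (sqrt (1 + r\<^sup>2) + r * s)), (sqrt (1 + r\<^sup>2) + r * s)\<^sup>2))"
  (is "?L \<longleftrightarrow> ?R")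
proof
  assume ?L
  then obtain t where t: "- (1 / k\<^sup>2) \<le> t" "t \<le> T"
    and p: "a = t" "b = (1 - h\<^sup>2 * t - Gamma_fun h t) / h" "c = Gamma_fun h t" by auto
  note G = Gamma_arc[OF t(1)]
  have "k\<^sup>2 * t \<le> k\<^sup>2 * T" using t by (intro mult_left_mono) auto
  then show ?R
    by (intro exI[of _ "k * sqrt (t + 1 / k\<^sup>2)"]) (use G in \<open>simp add: p\<close>)
next
  assume ?R
  then obtain s where s: "0 \<le> s" "s\<^sup>2 \<le> k\<^sup>2 * T + 1" and p: "k\<^sup>2 * a = s\<^sup>2 - 1"
    "k * b = - (2 * s * (sqrt (1 + r\<^sup>2) + r * s))" "c = (sqrt (1 + r\<^sup>2) + r * s)\<^sup>2" by auto
  have s2: "s\<^sup>2 = k\<^sup>2 * (a + 1 / k\<^sup>2)" using p(1) k_pos by (simp add: distrib_left)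
  then have "0 \<le> k\<^sup>2 * (a + 1 / k\<^sup>2)" by (metis zero_le_power2)
  then have a: "- (1 / k\<^sup>2) \<le> a" using k_pos by (simp add: zero_le_mult_iff)
  have "k\<^sup>2 * a \<le> k\<^sup>2 * T" using p(1) s(2) by simp
  then have "a \<le> T" using k_pos by simp
  have "s = k * sqrt (a + 1 / k\<^sup>2)"
    using s(1) s2 k_pos by (metis abs_of_nonneg less_imp_le real_sqrt_abs real_sqrt_mult)
  with Gamma_arc[OF a] p have "c = Gamma_fun h a" "k * b = k * ((1 - h\<^sup>2 * a - Gamma_fun h a) / h)"
    by simp_all
  then have "b = (1 - h\<^sup>2 * a - Gamma_fun h a) / h" using k_pos by (metis less_irrefl mult_left_cancel)
  with \<open>c = Gamma_fun h a\<close> a \<open>a \<le> T\<close> show ?L by auto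
qed

text \<open>The vertex on the top edge is \<open>sqrt (1 - s)\<close>.\<close>
lemma ridge_family_iff:
  "(\<exists>s\<in>{0..(2 * h + 1) / k\<^sup>2}. (a, b, c) = (- (1 / k\<^sup>2), 2 * sqrt (1 - s) / k, s)) \<longleftrightarrow>
    (k\<^sup>2 * a, k * b, c) \<in> ridge r"
  (is "?L \<longleftrightarrow> ?R")
proof -
  have r2: "(2 * h + 1) / k\<^sup>2 = 1 - r\<^sup>2" using k_pos
    by (simp add: r power_divide divide_simps) (simp add: k power2_eq_square algebra_simps)
  show ?thesis
  proof
    assume ?L
    then have s: "0 \<le> c" "c \<le> 1 - r\<^sup>2" and p: "a = - (1 / k\<^sup>2)" "b = 2 * sqrt (1 - c) / k"
      by (auto simp: r2)
    have "c \<le> 1" using s(2) zero_le_power2[of r] by linarith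
    then have "(sqrt (1 - c))\<^sup>2 = 1 - c" by simp
    moreover have "r \<le> sqrt (1 - c)" "sqrt (1 - c) \<le> 1" using s by (auto intro: real_le_rsqrt)
    ultimately show ?R unfolding ridge_def p mem_Collect_eq
      by (intro exI[of _ "sqrt (1 - c)"]) (use k_pos in auto)
  next
    assume ?R
    then obtain u where u: "r \<le> u" "u \<le> 1" and p: "k\<^sup>2 * a = - 1" "k * b = 2 * u" "c = 1 - u\<^sup>2"
      unfolding ridge_def by auto
    have "0 \<le> u" using u r_pos by simp
    then have "r\<^sup>2 \<le> u\<^sup>2" "u\<^sup>2 \<le> 1" "sqrt (1 - c) = u" using u r_pos p by (auto simp: power_le_one intro: power_mono)
    moreover have "a = - (1 / k\<^sup>2)" "b = 2 * u / k" using p k_pos by (simp_all add: field_simps)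
    ultimately show ?L using p by (auto simp: r2)
  qed
qed

text \<open>The parameter \<open>s\<close> is the square of \<open>w\<close> on the arc \<open>f 0 = 1\<close> of \<open>valley\<close>.\<close>
lemma sqrt_two_family_iff:
  "(\<exists>s\<in>{2..((sqrt (2 * h\<^sup>2 + 2 * h + 1) + sqrt 2 * h) / k)\<^sup>2}.
      (a, b, c) = (1 / k\<^sup>2, - (2 * sqrt (2 * s) / k), s)) \<longleftrightarrow>
    (\<exists>w. sqrt 2 \<le> w \<and> w \<le> sqrt (1 + r\<^sup>2) + r * sqrt 2 \<and>
      (k\<^sup>2 * a, k * b, c) = (1, - (2 * sqrt 2 * w), w\<^sup>2))"
  (is "?L \<longleftrightarrow> ?R")
proof -
  define W where "W = sqrt (1 + r\<^sup>2) + r * sqrt 2"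
  have "0 \<le> W" using r_pos by (simp add: W_def)
  have "sqrt (2 * h\<^sup>2 + 2 * h + 1) = k * sqrt (1 + r\<^sup>2)"
    using k_pos by (simp add: k2_r2[symmetric] real_sqrt_mult)
  then have W: "(sqrt (2 * h\<^sup>2 + 2 * h + 1) + sqrt 2 * h) / k = W"
    using k_pos kr[symmetric] by (simp add: W_def field_simps)
  show ?thesis
    unfolding W W_def[symmetric]
  proof
    assume "\<exists>s\<in>{2..W\<^sup>2}. (a, b, c) = (1 / k\<^sup>2, - (2 * sqrt (2 * s) / k), s)"
    then have s: "2 \<le> c" "c \<le> W\<^sup>2" and p: "a = 1 / k\<^sup>2" "b = - (2 * sqrt (2 * c) / k)" by auto
    have "sqrt c \<le> W" using s(2) \<open>0 \<le> W\<close> by (simp add: real_le_lsqrt)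
    then show "\<exists>w. sqrt 2 \<le> w \<and> w \<le> W \<and> (k\<^sup>2 * a, k * b, c) = (1, - (2 * sqrt 2 * w), w\<^sup>2)"
      by (intro exI[of _ "sqrt c"]) (use s k_pos in \<open>auto simp: p real_sqrt_mult\<close>)
  next
    assume "\<exists>w. sqrt 2 \<le> w \<and> w \<le> W \<and> (k\<^sup>2 * a, k * b, c) = (1, - (2 * sqrt 2 * w), w\<^sup>2)"
    then obtain w where w: "sqrt 2 \<le> w" "w \<le> W"
      and p: "k\<^sup>2 * a = 1" "k * b = - (2 * sqrt 2 * w)" "c = w\<^sup>2" by auto
    have "0 \<le> sqrt (2::real)" by simp
    then have "0 \<le> w" using w(1) by linarith
    then have "(sqrt 2)\<^sup>2 \<le> w\<^sup>2" "w\<^sup>2 \<le> W\<^sup>2" using w by (intro power_mono; simp)+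
    moreover have "a = 1 / k\<^sup>2" "b = - (2 * sqrt (2 * c) / k)"
      using p k_pos \<open>0 \<le> w\<close> by (simp_all add: real_sqrt_mult field_simps)
    ultimately show "\<exists>s\<in>{2..W\<^sup>2}. (a, b, c) = (1 / k\<^sup>2, - (2 * sqrt (2 * s) / k), s)"
      using p by auto
  qed
qed

lemma point_iff: "(k\<^sup>2 * a, k * b, c) = (A, B, C) \<longleftrightarrow> (a, b, c) = (A / k\<^sup>2, B / k, C)"
  using k_pos by (auto simp: field_simps)

text \<open>Above the threshold \<open>s \<le> sqrt 2\<close> already keeps the vertex \<open>s / w\<close> on the right edge, so
  \<open>f 0 \<le> 1\<close> is what limits the first arc, and the second arc is nonempty.\<close>
lemma valley_above_threshold:
  assumes "\<not> r\<^sup>2 - 4 * r + 1 > 0"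
  shows "(k\<^sup>2 * a, k * b, c) \<in> valley r \<longleftrightarrow>
    (\<exists>t\<in>{- (1 / k\<^sup>2)..1 / k\<^sup>2}. (a, b, c) = (t, (1 - h\<^sup>2 * t - Gamma_fun h t) / h, Gamma_fun h t)) \<or>
    (\<exists>s\<in>{2..((sqrt (2 * h\<^sup>2 + 2 * h + 1) + sqrt 2 * h) / k)\<^sup>2}.
      (a, b, c) = (1 / k\<^sup>2, - (2 * sqrt (2 * s) / k), s))"
proof -
  have "0 \<le> s \<Longrightarrow> s \<le> sqrt 2 \<and> s \<le> sqrt (1 + r\<^sup>2) + r * s \<longleftrightarrow> s\<^sup>2 \<le> k\<^sup>2 * (1 / k\<^sup>2) + 1" for s
  proof -
    assume "0 \<le> s"
    then have 2: "s \<le> sqrt 2 \<longleftrightarrow> s\<^sup>2 \<le> 2"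
      by (metis abs_of_nonneg real_sqrt_abs real_sqrt_le_iff)
    have "(1 - r) * s \<le> sqrt (1 + r\<^sup>2)" if "s\<^sup>2 \<le> 2"
    proof (rule real_le_rsqrt)
      have "((1 - r) * s)\<^sup>2 = (1 - r)\<^sup>2 * s\<^sup>2" by (simp add: power_mult_distrib)
      also have "\<dots> \<le> (1 - r)\<^sup>2 * 2" using that by (intro mult_left_mono) auto
      also have "\<dots> \<le> 1 + r\<^sup>2" using assms by (simp add: power2_eq_square algebra_simps)
      finally show "((1 - r) * s)\<^sup>2 \<le> 1 + r\<^sup>2" .
    qed
    then show ?thesis using 2 k_pos by (auto simp: algebra_simps)
  qed
  then show ?thesis unfolding valley_iff Gamma_family_iff sqrt_two_family_iff by blast
qed

text \<open>Below the threshold the vertex reaches \<open>y = 1\<close> first. That limits the first arc, and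
  the second arc is empty.\<close>
lemma valley_below_threshold:
  assumes below: "r\<^sup>2 - 4 * r + 1 > 0"
  shows "(k\<^sup>2 * a, k * b, c) \<in> valley r \<longleftrightarrow>
    (\<exists>t\<in>{- (1 / k\<^sup>2)..2 * h / k}. (a, b, c) = (t, (1 - h\<^sup>2 * t - Gamma_fun h t) / h, Gamma_fun h t))"
proof -
  have k2: "k\<^sup>2 * (2 * h / k) + 1 = k\<^sup>2 * (1 + r\<^sup>2)"
  proof -
    have "k\<^sup>2 * (2 * h / k) = 2 * h * k" using k_pos by (simp add: power2_eq_square)
    moreover have "2 * h * k + 1 = k\<^sup>2 * (1 + r\<^sup>2)"
      unfolding k2_r2 by (simp add: k power2_eq_square algebra_simps)
    ultimately show ?thesis by simp
  qed
  have k1: "k * (1 - r) = 1" using kr k by (simp add: right_diff_distrib)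
  have lt: "1 + r\<^sup>2 < (1 - r)\<^sup>2 * 2" using below by (simp add: power2_eq_square algebra_simps)
  have "0 \<le> s \<Longrightarrow> s \<le> sqrt 2 \<and> s \<le> sqrt (1 + r\<^sup>2) + r * s \<longleftrightarrow> s\<^sup>2 \<le> k\<^sup>2 * (2 * h / k) + 1" for s
  proof -
    assume "0 \<le> s"
    then have 2: "s \<le> sqrt 2 \<longleftrightarrow> s\<^sup>2 \<le> 2"
      by (metis abs_of_nonneg real_sqrt_abs real_sqrt_le_iff)
    have "0 \<le> (1 - r) * s" using \<open>0 \<le> s\<close> r_less_1 by simp
    then have "(1 - r) * s \<le> sqrt (1 + r\<^sup>2) \<longleftrightarrow> ((1 - r) * s)\<^sup>2 \<le> 1 + r\<^sup>2"
      by (metis abs_of_nonneg real_sqrt_abs real_sqrt_le_iff)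
    also have "\<dots> \<longleftrightarrow> k\<^sup>2 * ((1 - r) * s)\<^sup>2 \<le> k\<^sup>2 * (1 + r\<^sup>2)" using k_pos by simp
    also have "k\<^sup>2 * ((1 - r) * s)\<^sup>2 = s\<^sup>2" using k1 by algebra
    finally have 1: "s \<le> sqrt (1 + r\<^sup>2) + r * s \<longleftrightarrow> s\<^sup>2 \<le> k\<^sup>2 * (1 + r\<^sup>2)" by (simp add: algebra_simps)
    have "k\<^sup>2 * (1 + r\<^sup>2) \<le> k\<^sup>2 * ((1 - r)\<^sup>2 * 2)" using lt by (intro mult_left_mono) auto
    also have "\<dots> = 2" using k1 by algebra
    finally show ?thesis unfolding k2 1 2 by linarith
  qed
  moreover have "\<not> (sqrt 2 \<le> w \<and> w \<le> sqrt (1 + r\<^sup>2) + r * sqrt 2)" for w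
  proof
    assume "sqrt 2 \<le> w \<and> w \<le> sqrt (1 + r\<^sup>2) + r * sqrt 2"
    then have "(1 - r) * sqrt 2 \<le> sqrt (1 + r\<^sup>2)" by (simp add: algebra_simps)
    then have "((1 - r) * sqrt 2)\<^sup>2 \<le> (sqrt (1 + r\<^sup>2))\<^sup>2" using r_less_1 by (intro power_mono) auto
    with lt show False by (simp add: power_mult_distrib)
  qed
  ultimately show ?thesis unfolding valley_iff Gamma_family_iff by blast
qed

end

section \<open>The extreme points of the unit ball\<close>

text \<open>It remains to undo the scaling of the coefficients in \<open>ext_normal_ball\<close>: with \<open>r = h / k\<close>, the
  entries of the isolated points become rational functions of \<open>h\<close>.\<close>
theorem theorem5p1:
  fixes h :: real
  assumes "h > 0"
  shows "(h \<ge> (sqrt 3 - 1) / 2 \<longrightarrow>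
      ext (unit_ball h) = plus_minus (
          {(t, (1 - h^2 * t - Gamma_fun h t) / h, Gamma_fun h t) | t.
             t \<in> {- (1 / (h + 1)^2)..1 / (h + 1)^2}}
        \<union> {(- (1 / (h + 1)^2), 2 * sqrt (1 - s) / (h + 1), s) | s.
             s \<in> {0..(2 * h + 1) / (h + 1)^2}}
        \<union> {(1 / (h + 1)^2, - (2 * sqrt (2 * s) / (h + 1)), s) | s.
             s \<in> {2..((sqrt (2 * h^2 + 2 * h + 1) + sqrt 2 * h) / (h + 1))^2}}
        \<union> {(0, 0, 1),
           (1 / (h + 1)^2, 0, 0),
           (1 / (h + 1)^2, - ((2 * h + 1) / (h + 1)^2), (2 * h + 1) / (h + 1))}))
    \<and> (h < (sqrt 3 - 1) / 2 \<longrightarrow>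
      ext (unit_ball h) = plus_minus (
          {(t, (1 - h^2 * t - Gamma_fun h t) / h, Gamma_fun h t) | t.
             t \<in> {- (1 / (h + 1)^2)..2 * h / (h + 1)}}
        \<union> {(- (1 / (h + 1)^2), 2 * sqrt (1 - s) / (h + 1), s) | s.
             s \<in> {0..(2 * h + 1) / (h + 1)^2}}
        \<union> {(0, 0, 1),
           (1 / (h + 1)^2, - ((2 * h^2 + 6 * h + 3) / (h + 1)^2),
             (2 * h^2 + 4 * h + 1) / (h + 1)),
           (1 / (h + 1)^2, 0, 0),
           (1 / (h + 1)^2, - ((2 * h + 1) / (h + 1)^2), (2 * h + 1) / (h + 1))}))"
proof -
  define k where "k = h + 1"
  define r where "r = h / k"
  note hkr = assms k_def r_def
  note k_pos = k_pos[OF hkr] and r = r_pos[OF hkr] r_less_1[OF hkr]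
  have pull_back: "ext (unit_ball h) = plus_minus S"
    if S: "\<And>a b c. (a, b, c) \<in> S \<longleftrightarrow> (k\<^sup>2 * a, k * b, c) \<in> normal_extreme r" for S
  proof -
    have "(a, b, c) \<in> ext (unit_ball h) \<longleftrightarrow> (a, b, c) \<in> plus_minus S" for a b c
      using S[of a b c] S[of "- a" "- b" "- c"]
      by (simp add: ext_unit_ball_iff[OF assms k_def] r_def[symmetric] ext_normal_ball[OF r] mem_plus_minus)
    then show ?thesis by auto
  qed
  note scaled = point_iff[OF hkr]
  have one_r: "1 + r = (2 * h + 1) / k" "1 - r = 1 / k" using k_pos by (simp_all add: r_def k_def field_simps)
  then have d: "- (1 + r) / k = - ((2 * h + 1) / k\<^sup>2)" by (simp add: power2_eq_square)
  have triangle: "(k\<^sup>2 * a, k * b, c) = (1, - (1 + r), 1 + r) \<longleftrightarrow>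
      (a, b, c) = (1 / k\<^sup>2, - ((2 * h + 1) / k\<^sup>2), (2 * h + 1) / k)" for a b c
    unfolding scaled d by (simp add: one_r)
  have q: "(3 - r\<^sup>2) / (1 - r) = (2 * h\<^sup>2 + 6 * h + 3) / k"
    unfolding one_r using k_pos by (simp add: r_def power_divide divide_simps)
      (simp add: k_def power2_eq_square algebra_simps)
  have q2: "(2 * h\<^sup>2 + 6 * h + 3) / k - 2 = (2 * h\<^sup>2 + 4 * h + 1) / k"
    using k_pos by (simp add: divide_simps) (simp add: k_def algebra_simps)
  have q1: "- ((2 * h\<^sup>2 + 6 * h + 3) / k) / k = - ((2 * h\<^sup>2 + 6 * h + 3) / k\<^sup>2)"
    by (simp add: power2_eq_square)
  have below_point: "(k\<^sup>2 * a, k * b, c) = (1, - ((3 - r\<^sup>2) / (1 - r)), (3 - r\<^sup>2) / (1 - r) - 2) \<longleftrightarrow>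
      (a, b, c) = (1 / k\<^sup>2, - ((2 * h\<^sup>2 + 6 * h + 3) / k\<^sup>2), (2 * h\<^sup>2 + 4 * h + 1) / k)" for a b c
    unfolding q q2 scaled q1 ..
  have unit_points: "(k\<^sup>2 * a, k * b, c) = (0, 0, 1) \<longleftrightarrow> (a, b, c) = (0, 0, 1)"
    "(k\<^sup>2 * a, k * b, c) = (1, 0, 0) \<longleftrightarrow> (a, b, c) = (1 / k\<^sup>2, 0, 0)" for a b c
    unfolding scaled by simp_all
  show ?thesis
    unfolding k_def[symmetric]
  proof (intro conjI impI, goal_cases)
    case 1
    then have above: "\<not> r\<^sup>2 - 4 * r + 1 > 0" using threshold_iff[OF hkr] by simp
    show ?case
    proof (rule pull_back, goal_cases)
      case (1 a b c)
      show ?case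
        unfolding normal_extreme_def if_not_P[OF above] Un_iff insert_iff empty_iff
          valley_above_threshold[OF hkr above] ridge_family_iff[OF hkr, symmetric] unit_points triangle
          mem_Collect_eq
        by blast
    qed
  next
    case 2
    then have below: "r\<^sup>2 - 4 * r + 1 > 0" using threshold_iff[OF hkr] by linarith
    show ?case
    proof (rule pull_back, goal_cases)
      case (1 a b c)
      show ?case
        unfolding normal_extreme_def if_P[OF below] Un_iff insert_iff empty_iff
          valley_below_threshold[OF hkr below] ridge_family_iff[OF hkr, symmetric] unit_points triangle
          below_point mem_Collect_eq
        by blast
    qed
  qed
qed

end
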